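(* Let $\theta_t:\mathbb{R}^{(m+1)n}\to\mathbb{C}$, $t>0$, satisfy the size and regularity conditions (K1)–(K3) of the context, and suppose that the associated square function $S$ is bounded from $L^{p_1}\times\cdots\times L^{p_m}$ into $L^p$ for some $1\le p,p_1,\dots,p_m\le\infty$ with $\frac1p=\sum_{i=1}^m\frac1{p_i}$. Then there is a constant $C$ such that for all $f_1,\dots,f_m\in L_c^\infty(\mathbb{R}^n)$ $$\|S(f_1,\dots,f_m)\|_{BMO}\le C\prod_{i=1}^m\|f_i\|_{L^\infty},$$ where $C$ is independent of $f_1,\dots,f_m$ (and in particular of their supports).
   Context: $L_c^\infty(\mathbb{R}^n)$ is the set of $L^\infty$ functions with compact support. $\Theta_t(f_1,\dots,f_m)(x)=\int_{\mathbb{R}^{mn}}\theta_t(x,y_1,\dots,y_m)\prod_{i=1}^m f_i(y_i)\,dy_1\cdots dy_m$ and $S(f_1,\dots,f_m)(x)=\left(\int_0^\infty|\Theta_t(f_1,\dots,f_m)(x)|^2\frac{dt}{t}\right)^{1/2}$. $S$ bounded from $L^{p_1}\times\cdots\times L^{p_m}$ into $L^p$ means $\|S(f_1,\dots,f_m)\|_{L^p}\le C'\prod_i\|f_i\|_{L^{p_i}}$ for all $f_i\in L^{p_i}$, with $C'$ independent of the $f_i$. Kernel conditions: there are constants $N>n$, $0<\gamma\le1$ and $A>0$ (independent of $t$ and of all points) such that for all $t>0$ and all $x,x',y_1,\dots,y_m,y_1',\dots,y_m'\in\mathbb{R}^n$: (K1) $|\theta_t(x,y_1,\dots,y_m)|\le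 A\,\dfrac{t^{-mn}}{\prod_{j=1}^m(1+t^{-1}|x-y_j|)^{N+\gamma}}$; (K2) for each $i=1,\dots,m$, $|\theta_t(x,y_1,\dots,y_m)-\theta_t(x,y_1,\dots,y_i',\dots,y_m)|\le A\,\dfrac{t^{-mn}(t^{-1}|y_i-y_i'|)^\gamma}{\prod_{j=1}^m(1+t^{-1}|x-y_j|)^{N+\gamma}}$; (K3) $|\theta_t(x,y_1,\dots,y_m)-\theta_t(x',y_1,\dots,y_m)|\le A\,\dfrac{t^{-mn}(t^{-1}|x-x'|)^\gamma}{\prod_{j=1}^m(1+t^{-1}|x-y_j|)^{N+\gamma}}$. *)

theory Defs
  imports "HOL-Analysis.Analysis" "HOL-Probability.Essential_Supremum"
begin

text \<open>
  The spatial dimension is \<open>CARD('n)\<close> and the degree of multilinearity is \<open>CARD('m)\<close>.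
  A point of the \<open>m\<close>-fold product of \<open>n\<close>-space is \<open>y :: real^'n^'m\<close>, whose component
  \<open>y $ j :: real^'n\<close> is the \<open>j\<close>-th vector. A tuple of functions is
  \<open>f :: 'm \<Rightarrow> real^'n \<Rightarrow> complex\<close>. Measurable functions are Lebesgue measurable.
\<close>

text \<open>Powers of extended nonnegative reals, used for positive exponents only.\<close>

definition enn_powr :: "ennreal \<Rightarrow> real \<Rightarrow> ennreal" where
  "enn_powr u a = (if u = \<infinity> then \<infinity> else ennreal (enn2real u powr a))"

text \<open>
  The norm takes an extended-valued modulus, because a square function may be infinite;
  \<open>p \<in> [1,\<infinity>]\<close>.
\<close>

definition Lp_norm :: "ennreal \<Rightarrow> ('a::euclidean_space \<Rightarrow> ennreal) \<Rightarrow> ennreal" where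
  "Lp_norm p g =
     (if p = \<infinity> then esssup lebesgue g
      else enn_powr (\<integral>\<^sup>+x. enn_powr (g x) (enn2real p) \<partial>lebesgue) (1 / enn2real p))"

definition Lp_norm_complex :: "ennreal \<Rightarrow> ('a::euclidean_space \<Rightarrow> complex) \<Rightarrow> ennreal" where
  "Lp_norm_complex p f = Lp_norm p (\<lambda>x. ennreal (cmod (f x)))"

definition in_Lp :: "ennreal \<Rightarrow> ('a::euclidean_space \<Rightarrow> complex) \<Rightarrow> bool" where
  "in_Lp p f \<longleftrightarrow> f \<in> borel_measurable lebesgue \<and> Lp_norm_complex p f < \<infinity>"

text \<open>Compact support is understood modulo null sets, as for elements of \<open>L\<^sup>\<infinity>\<close>.\<close>

definition in_Linf_compact_support :: "('a::euclidean_space \<Rightarrow> complex) \<Rightarrow> bool" where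
  "in_Linf_compact_support f \<longleftrightarrow>
     in_Lp \<infinity> f \<and> (\<exists>K. compact K \<and> (AE x in lebesgue. x \<notin> K \<longrightarrow> f x = 0))"

definition cubes :: "(real^'n) set set" where
  "cubes = {cbox a (a + vec l) | a l. l > 0}"

definition average :: "'a::euclidean_space set \<Rightarrow> ('a \<Rightarrow> real) \<Rightarrow> real" where
  "average Q g = (LINT x:Q|lebesgue. g x) / measure lebesgue Q"

definition locally_integrable :: "('a::euclidean_space \<Rightarrow> real) \<Rightarrow> bool" where
  "locally_integrable g \<longleftrightarrow> (\<forall>K. compact K \<longrightarrow> set_integrable lebesgue K g)"

definition BMO_norm :: "(real^'n \<Rightarrow> real) \<Rightarrow> ennreal" where
  "BMO_norm g =
     (if locally_integrable g
      then (SUP Q\<in>cubes. ennreal (average Q (\<lambda>x. \<bar>g x - average Q g\<bar>)))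
      else \<infinity>)"

definition kernel_majorant ::
  "real \<Rightarrow> real \<Rightarrow> real \<Rightarrow> real^'n \<Rightarrow> real^'n^'m \<Rightarrow> real" where
  "kernel_majorant N \<gamma> t x y =
     t powr (- real (CARD('m) * CARD('n)))
       / (\<Prod>j\<in>UNIV. (1 + norm (x - y $ j) / t) powr (N + \<gamma>))"

definition replace_component :: "'a^'m \<Rightarrow> 'm \<Rightarrow> 'a \<Rightarrow> 'a^'m" where
  "replace_component y i z = (\<chi> j. if j = i then z else y $ j)"

definition kernel_conditions ::
  "(real \<Rightarrow> real^'n \<Rightarrow> real^'n^'m \<Rightarrow> complex) \<Rightarrow> bool" where
  "kernel_conditions \<theta> \<longleftrightarrow>
     (\<exists>N \<gamma> A. N > real CARD('n) \<and> 0 < \<gamma> \<and> \<gamma> \<le> 1 \<and> A > 0 \<and>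
       (\<forall>t>0. \<forall>x y. cmod (\<theta> t x y) \<le> A * kernel_majorant N \<gamma> t x y) \<and>
       (\<forall>t>0. \<forall>x y i z. cmod (\<theta> t x y - \<theta> t x (replace_component y i z))
            \<le> A * (norm (y $ i - z) / t) powr \<gamma> * kernel_majorant N \<gamma> t x y) \<and>
       (\<forall>t>0. \<forall>x x' y. cmod (\<theta> t x y - \<theta> t x' y)
            \<le> A * (norm (x - x') / t) powr \<gamma> * kernel_majorant N \<gamma> t x y))"

definition multilinear_op ::
  "(real \<Rightarrow> real^'n \<Rightarrow> real^'n^'m \<Rightarrow> complex) \<Rightarrow> real \<Rightarrow> ('m \<Rightarrow> real^'n \<Rightarrow> complex)
    \<Rightarrow> real^'n \<Rightarrow> complex" where
  "multilinear_op \<theta> t f x = (LINT y|lebesgue. \<theta> t x y * (\<Prod>i\<in>UNIV. f i (y $ i)))"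

definition square_function ::
  "(real \<Rightarrow> real^'n \<Rightarrow> real^'n^'m \<Rightarrow> complex) \<Rightarrow> ('m \<Rightarrow> real^'n \<Rightarrow> complex)
    \<Rightarrow> real^'n \<Rightarrow> ennreal" where
  "square_function \<theta> f x =
     enn_powr (\<integral>\<^sup>+t\<in>{0<..}. ennreal ((cmod (multilinear_op \<theta> t f x))\<^sup>2 / t) \<partial>lebesgue) (1 / 2)"

definition square_function_bounded ::
  "(real \<Rightarrow> real^'n \<Rightarrow> real^'n^'m \<Rightarrow> complex) \<Rightarrow> ('m \<Rightarrow> ennreal) \<Rightarrow> ennreal \<Rightarrow> bool" where
  "square_function_bounded \<theta> q p \<longleftrightarrow>
     (\<exists>C'::real. \<forall>f. (\<forall>i. in_Lp (q i) (f i)) \<longrightarrow>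
        Lp_norm p (square_function \<theta> f) \<le> ennreal C' * (\<Prod>i\<in>UNIV. Lp_norm_complex (q i) (f i)))"

end

(*
  Fix a cube Q, let Q' be its threefold enlargement, split each function at the boundary of Q', and
  write the product of the f_i as the local product (all f_i cut off to Q') plus a far remainder.
  On Q the square function of f differs from that of the remainder by at most the square function
  of the cut-off functions, whose mean over Q is controlled by the assumed L^{p_1} x ... x L^{p_m} -> L^p
  bound.  The square function of the remainder is constant on Q up to O(prod ||f_i||_inf): two values
  of its t-th term differ by O(min(t/l, l/t)^gamma), where l is the side of Q, by the size condition
  away from Q' for t < l and by the regularity in x for t > l, and this is square integrable for dt/t
  with a norm independent of l.
*)

theory Submission
  imports Defs
begin

section \<open>Measure-theoretic preliminaries\<close>

text \<open>The exponent \<open>N + \<gamma>\<close> of the majorant does two jobs. As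
  \<open>N\<close> exceeds the dimension, the part \<open>N\<close> makes each one-variable factor
  integrable uniformly in \<open>t\<close>; the part \<open>\<gamma>\<close> is kept as the gain
  \<open>(t / l) powr \<gamma>\<close> when one variable stays at distance at least \<open>l\<close>
  from \<open>x\<close>. The far remainder need not be a product of functions of single variables,
  so the kernel acts below on bounded functions of all of \<open>y\<close>.

  The square functions may be infinite, so they are compared by additive inequalities in
  \<open>ennreal\<close>; the value compared with the mean must nevertheless be finite. This is
  where compact support enters: the \<open>f i\<close> then lie in every Lebesgue space, so the
  assumed bound makes the square function locally integrable and finite almost everywhere. Only this
  qualitative fact depends on the supports; the constant uses the bound for functions cut off to Q',
  where the relation between the exponents cancels the size of the cube.

  Measurability in \<open>t\<close> is given for fixed \<open>x\<close> and \<open>y\<close>. Joint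
  measurability comes from Hoelder continuity: in \<open>y\<close> by (K2), and in \<open>x\<close>,
  after integration, by (K3).\<close>

lemma mem_box_vec:
  "x \<in> box l u \<longleftrightarrow> (\<forall>i. x $ i \<in> box (l $ i) (u $ i))" for x :: "'a::euclidean_space^'m"
  by (auto simp: mem_box Basis_vec_def inner_axis)

lemma measurable_vec_nth_borel[measurable]:
  "(\<lambda>y::'a::euclidean_space^'m. y $ j) \<in> borel_measurable borel"
  by (intro borel_measurable_continuous_onI continuous_intros)

lemma measurable_vec_lambda_PiM:
  "vec_lambda \<in> (\<Pi>\<^sub>M i\<in>(UNIV::'m::finite set). (lborel :: 'a::euclidean_space measure)) \<rightarrow>\<^sub>M borel"
proof (subst borel_measurable_euclidean_space, intro ballI)
  fix b :: "'a^'m" assume "b \<in> Basis"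
  then obtain i u where b: "b = axis i u" "u \<in> Basis" by (auto simp: Basis_vec_def)
  show "(\<lambda>f. vec_lambda f \<bullet> b) \<in> borel_measurable (\<Pi>\<^sub>M i\<in>UNIV. lborel)"
    unfolding b inner_axis by simp
qed

text \<open>Boxes in \<open>'a^'m\<close> are products of boxes in \<open>'a\<close>, and a Borel
  measure with the right values on boxes is \<open>lborel\<close>. This opens the way to product
  integration over the vector components.\<close>

lemma lborel_vec_eq:
  "(lborel :: ('a::euclidean_space^'m) measure) = distr (\<Pi>\<^sub>M i\<in>UNIV. lborel) borel vec_lambda"
proof (rule lborel_eqI)
  interpret product_sigma_finite "\<lambda>_::'m. lborel :: 'a measure"
    by standard
  fix l u :: "'a^'m" assume lu: "\<And>b. b \<in> Basis \<Longrightarrow> l \<bullet> b \<le> u \<bullet> b"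
  have lu': "l $ i \<bullet> b \<le> u $ i \<bullet> b" if "b \<in> Basis" for i b
    using lu[of "axis i b"] that by (auto simp: Basis_vec_def inner_axis)
  have pre: "vec_lambda -` box l u \<inter> space (\<Pi>\<^sub>M i\<in>UNIV. lborel) = (\<Pi>\<^sub>E i\<in>UNIV. box (l $ i) (u $ i))"
    by (auto simp: mem_box_vec space_PiM PiE_iff)
  have "emeasure (distr (\<Pi>\<^sub>M i\<in>UNIV. lborel) borel vec_lambda) (box l u)
      = (\<Prod>i\<in>UNIV. emeasure lborel (box (l $ i) (u $ i)))"
    by (simp add: emeasure_distr[OF measurable_vec_lambda_PiM] pre emeasure_PiM)
  also have "\<dots> = (\<Prod>i\<in>UNIV. ennreal (\<Prod>b\<in>Basis. (u $ i - l $ i) \<bullet> b))"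
    using lu' by simp
  also have "\<dots> = ennreal (\<Prod>i\<in>UNIV. \<Prod>b\<in>Basis. (u $ i - l $ i) \<bullet> b)"
    by (rule prod_ennreal) (auto intro!: prod_nonneg simp: inner_diff_left lu')
  also have "(\<Prod>i\<in>UNIV. \<Prod>b\<in>Basis. (u $ i - l $ i) \<bullet> b) = (\<Prod>b\<in>Basis. (u - l) \<bullet> b)"
  proof -
    have "(\<Union>i. \<Union>b\<in>Basis. {axis i b}) = (\<lambda>(i,b). axis i b :: 'a^'m) ` (UNIV \<times> Basis)"
      by auto
    moreover have "inj_on (\<lambda>(i,b). axis i b :: 'a^'m) (UNIV \<times> Basis)"
      by (auto simp: inj_on_def axis_eq_axis)
    ultimately show ?thesis
      by (simp add: Basis_vec_def prod.reindex prod.cartesian_product inner_axis case_prod_unfold)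
  qed
  finally show "emeasure (distr (\<Pi>\<^sub>M i\<in>UNIV. lborel) borel vec_lambda) (box l u)
      = ennreal (\<Prod>b\<in>Basis. (u - l) \<bullet> b)" .
qed simp

lemma nn_integral_prod_vec:
  fixes f :: "'m::finite \<Rightarrow> 'a::euclidean_space \<Rightarrow> ennreal"
  assumes [measurable]: "\<And>i. f i \<in> borel_measurable borel"
  shows "(\<integral>\<^sup>+y. (\<Prod>i\<in>UNIV. f i (y $ i)) \<partial>lborel) = (\<Prod>i\<in>UNIV. \<integral>\<^sup>+x. f i x \<partial>lborel)"
proof -
  interpret product_sigma_finite "\<lambda>_::'m. lborel :: 'a measure"
    by standard
  have "(\<integral>\<^sup>+y. (\<Prod>i\<in>UNIV. f i (y $ i)) \<partial>lborel)
      = (\<integral>\<^sup>+y. (\<Prod>i\<in>UNIV. f i (y i)) \<partial>(\<Pi>\<^sub>M i\<in>UNIV. lborel))"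
    by (subst lborel_vec_eq, subst nn_integral_distr[OF measurable_vec_lambda_PiM]) simp_all
  also have "\<dots> = (\<Prod>i\<in>UNIV. \<integral>\<^sup>+x. f i x \<partial>lborel)"
    by (rule product_nn_integral_prod) auto
  finally show ?thesis .
qed

text \<open>The indicator of the preimage of a null set under one component is a product over the
  components, so its integral factors. Needed to change each \<open>f i\<close> on a null set inside
  an integral over \<open>y\<close>.\<close>

lemma AE_lborel_vec_nth:
  fixes P :: "'a::euclidean_space \<Rightarrow> bool"
  assumes "AE x in lborel. P x"
  shows "AE y::'a^'m in lborel. P (y $ j)"
proof -
  obtain N where N: "N \<in> null_sets lborel" "{x. \<not> P x} \<subseteq> N"
    using assms by (auto simp: eventually_ae_filter)
  then have [measurable]: "N \<in> sets borel" by auto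
  let ?N = "{y::'a^'m. y $ j \<in> N}"
  have "emeasure lborel ?N = (\<integral>\<^sup>+y. (\<Prod>i\<in>UNIV. (if i = j then indicator N (y $ i) else 1)) \<partial>lborel)"
  proof -
    have "(\<Prod>i\<in>UNIV. (if i = j then indicator N (y $ i) else 1)) = (indicator ?N y :: ennreal)" for y :: "'a^'m"
      by (simp add: indicator_def)
    then show ?thesis by simp
  qed
  also have "\<dots> = (\<Prod>i\<in>UNIV. \<integral>\<^sup>+x. (if i = j then indicator N x else 1) \<partial>(lborel :: 'a measure))"
    by (rule nn_integral_prod_vec) auto
  \<comment> \<open>The factors with \<open>i \<noteq> j\<close> are infinite; the product is still
    0 because \<open>0 * \<infinity> = 0\<close> in \<open>ennreal\<close>.\<close>
  also have "\<dots> = 0"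
    using N by (intro prod_zero) (auto intro!: exI[of _ j])
  finally have "?N \<in> null_sets lborel" by (auto simp: null_sets_def)
  then show ?thesis
    by (rule AE_I') (use N in auto)
qed

text \<open>Replace \<open>y\<close> by simple functions \<open>s i y\<close> converging to it. On
  each of the finitely many level sets the second argument is constant, which leaves measurability
  in \<open>x\<close>; continuity in \<open>y\<close> gives the pointwise limit.\<close>

lemma borel_measurable_Caratheodory:
  fixes F :: "'a \<Rightarrow> 'b::{metric_space, second_countable_topology} \<Rightarrow> 'c::metric_space"
  assumes meas: "\<And>y. (\<lambda>x. F x y) \<in> borel_measurable M"
    and cont: "\<And>x. x \<in> space M \<Longrightarrow> continuous_on UNIV (F x)"
  shows "(\<lambda>(x, y). F x y) \<in> borel_measurable (M \<Otimes>\<^sub>M borel)"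
proof -
  obtain s :: "nat \<Rightarrow> 'b \<Rightarrow> 'b" where s: "\<And>i. simple_function borel (s i)"
      "\<And>y. (\<lambda>i. s i y) \<longlonglongrightarrow> y"
    using borel_measurable_implies_sequence_metric[of "\<lambda>y::'b. y" borel undefined] by auto
  show ?thesis
  proof (rule borel_measurable_LIMSEQ_metric)
    fix i
    have fin: "finite (range (s i))"
      using simple_functionD(1)[OF s(1)] by simp
    have "s i \<in> borel \<rightarrow>\<^sub>M count_space (range (s i))"
      using simple_functionD[OF s(1)[of i]]
      by (auto simp: measurable_count_space_eq2[OF fin])
    then have 1: "(\<lambda>p. s i (snd p)) \<in> M \<Otimes>\<^sub>M borel \<rightarrow>\<^sub>M count_space (range (s i))"
      by (intro measurable_compose[OF measurable_snd])
    have 2: "(\<lambda>p. F (fst p) y) \<in> borel_measurable (M \<Otimes>\<^sub>M borel)" for y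
      by (rule measurable_compose[OF measurable_fst meas])
    show "(\<lambda>(x, y). F x (s i y)) \<in> borel_measurable (M \<Otimes>\<^sub>M borel)"
      using measurable_compose_countable'[OF 2 1 countable_finite[OF fin]]
      by (simp add: case_prod_unfold)
  next
    fix p assume "p \<in> space (M \<Otimes>\<^sub>M (borel :: 'b measure))"
    then have "isCont (F (fst p)) (snd p)"
      using cont by (auto simp: space_pair_measure continuous_on_eq_continuous_at)
    from isCont_tendsto_compose[OF this s(2)]
    show "(\<lambda>i. (case p of (x, y) \<Rightarrow> F x (s i y))) \<longlonglongrightarrow> (case p of (x, y) \<Rightarrow> F x y)"
      by (simp add: case_prod_unfold)
  qed
qed

section \<open>Real powers in \<open>ennreal\<close> and the L^2 norm for the measure dt/t\<close>

lemma enn_powr_ennreal: "0 \<le> r \<Longrightarrow> enn_powr (ennreal r) a = ennreal (r powr a)"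
  by (simp add: enn_powr_def)

lemma enn_powr_zero: "enn_powr 0 a = 0"
  by (simp add: enn_powr_def)

lemma enn_powr_top [simp]: "enn_powr \<infinity> a = \<infinity>" "enn_powr top a = top"
  by (simp_all add: enn_powr_def)

lemma enn_powr_mono: "u \<le> v \<Longrightarrow> 0 \<le> a \<Longrightarrow> enn_powr u a \<le> enn_powr v a"
  by (cases u; cases v) (auto simp: enn_powr_ennreal powr_mono2 top_unique ennreal_le_iff)

lemma enn_powr_powr: "enn_powr (enn_powr u a) b = enn_powr u (a * b)"
  by (cases u) (auto simp: enn_powr_ennreal powr_powr)

lemma enn_powr_one: "enn_powr u 1 = u"
  by (cases u) (auto simp: enn_powr_ennreal)

lemma enn_powr_half_power2: "(enn_powr u (1 / 2))\<^sup>2 = u"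
  by (cases u) (auto simp: enn_powr_ennreal ennreal_power powr_half_sqrt power2_eq_square ennreal_mult_top
      ennreal_mult[symmetric])

lemma enn_powr_power2_half: "enn_powr (u\<^sup>2) (1 / 2) = u"
  by (cases u) (auto simp: enn_powr_ennreal ennreal_power powr_half_sqrt power2_eq_square
      ennreal_mult[symmetric] ennreal_mult_top)

lemma measurable_enn_powr [measurable]: "(\<lambda>u. enn_powr u a) \<in> borel_measurable borel"
  unfolding enn_powr_def by measurable

text \<open>Expand the square and apply Cauchy-Schwarz to the cross term. Working in
  \<open>ennreal\<close> covers infinite norms as well.\<close>

lemma nn_integral_Minkowski_L2:
  fixes u v :: "'a \<Rightarrow> ennreal"
  assumes [measurable]: "u \<in> borel_measurable M" "v \<in> borel_measurable M"
  shows "enn_powr (\<integral>\<^sup>+x. (u x + v x)\<^sup>2 \<partial>M) (1 / 2)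
      \<le> enn_powr (\<integral>\<^sup>+x. (u x)\<^sup>2 \<partial>M) (1 / 2) + enn_powr (\<integral>\<^sup>+x. (v x)\<^sup>2 \<partial>M) (1 / 2)"
proof -
  let ?a = "enn_powr (\<integral>\<^sup>+x. (u x)\<^sup>2 \<partial>M) (1 / 2)" and ?b = "enn_powr (\<integral>\<^sup>+x. (v x)\<^sup>2 \<partial>M) (1 / 2)"
  have "(\<integral>\<^sup>+x. u x * v x \<partial>M)\<^sup>2 \<le> (?a * ?b)\<^sup>2"
    using Cauchy_Schwarz_nn_integral[OF assms] by (simp add: power_mult_distrib enn_powr_half_power2)
  from enn_powr_mono[OF this, of "1 / 2"] have uv: "(\<integral>\<^sup>+x. u x * v x \<partial>M) \<le> ?a * ?b"
    by (simp add: enn_powr_power2_half)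
  have "(\<integral>\<^sup>+x. (u x + v x)\<^sup>2 \<partial>M) = (\<integral>\<^sup>+x. (u x)\<^sup>2 + 2 * (u x * v x) + (v x)\<^sup>2 \<partial>M)"
    by (simp add: power2_sum algebra_simps)
  also have "\<dots> = ?a\<^sup>2 + 2 * (\<integral>\<^sup>+x. u x * v x \<partial>M) + ?b\<^sup>2"
    by (simp add: nn_integral_add nn_integral_cmult enn_powr_half_power2)
  also have "\<dots> \<le> ?a\<^sup>2 + 2 * (?a * ?b) + ?b\<^sup>2"
    using uv by (intro add_mono mult_left_mono) auto
  also have "\<dots> = (?a + ?b)\<^sup>2"
    by (simp add: power2_sum algebra_simps)
  finally show ?thesis
    using enn_powr_mono[of _ "(?a + ?b)\<^sup>2" "1 / 2"] by (simp add: enn_powr_power2_half)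
qed

text \<open>The norm of L^2 on the half-line for the dilation-invariant measure dt/t. The square
  function at \<open>x\<close> is this norm of the function taking \<open>t\<close> to
  \<open>multilinear_op \<theta> t f x\<close>.\<close>

definition dilation_L2_norm :: "(real \<Rightarrow> complex) \<Rightarrow> ennreal" where
  "dilation_L2_norm F =
     enn_powr (\<integral>\<^sup>+t\<in>{0<..}. ennreal ((cmod (F t))\<^sup>2 / t) \<partial>lebesgue) (1 / 2)"

lemma dilation_L2_norm_cong:
  "(\<And>t. 0 < t \<Longrightarrow> cmod (F t) = cmod (G t)) \<Longrightarrow> dilation_L2_norm F = dilation_L2_norm G"
  unfolding dilation_L2_norm_def
  by (intro arg_cong2[where f = enn_powr] nn_integral_cong) (auto simp: indicator_def)

text \<open>Stated as a pointwise domination, so that it serves for a sum, for a difference and for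
  the comparison of two points alike.\<close>

lemma dilation_L2_norm_triangle:
  assumes G: "G \<in> borel_measurable (lebesgue_on {0<..})"
    and H: "H \<in> borel_measurable (lebesgue_on {0<..})"
    and le: "\<And>t. 0 < t \<Longrightarrow> cmod (F t) \<le> cmod (G t) + cmod (H t)"
  shows "dilation_L2_norm F \<le> dilation_L2_norm G + dilation_L2_norm H"
proof -
  \<comment> \<open>The density 1/t is absorbed as a factor \<open>1 / sqrt t\<close>, which turns
    the norm into an ordinary L^2 norm.\<close>
  let ?u = "\<lambda>G t. ennreal (cmod (G t) / sqrt t) * indicator {0<..} (t::real)"
  have sq: "(?u G t)\<^sup>2 = ennreal ((cmod (G t))\<^sup>2 / t) * indicator {0<..} t" for G t
    by (auto simp: indicator_def ennreal_power power_divide)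
  have eq: "dilation_L2_norm G = enn_powr (\<integral>\<^sup>+t. (?u G t)\<^sup>2 \<partial>lebesgue) (1 / 2)" for G
    by (simp only: sq dilation_L2_norm_def)
  have meas: "?u G \<in> borel_measurable lebesgue"
    if [measurable]: "G \<in> borel_measurable (lebesgue_on {0<..})" for G
  proof -
    have [measurable]: "(\<lambda>t::real. t) \<in> borel_measurable (lebesgue_on {0<..})"
      using id_borel_measurable_lebesgue_on by (simp add: id_def)
    have "(\<lambda>t. ennreal (cmod (G t) / sqrt t)) \<in> borel_measurable (lebesgue_on {0<..})"
      by measurable
    then show ?thesis
      by (subst (asm) borel_measurable_restrict_space_iff_ennreal) auto
  qed
  have "(?u F t)\<^sup>2 \<le> (?u G t + ?u H t)\<^sup>2" for t
    using le[of t]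
    by (intro power_mono)
      (auto simp: indicator_def ennreal_plus[symmetric] add_divide_distrib[symmetric]
        intro!: ennreal_leI divide_right_mono simp del: ennreal_plus)
  then have "dilation_L2_norm F \<le> enn_powr (\<integral>\<^sup>+t. (?u G t + ?u H t)\<^sup>2 \<partial>lebesgue) (1 / 2)"
    unfolding eq by (intro enn_powr_mono nn_integral_mono) auto
  also have "\<dots> \<le> dilation_L2_norm G + dilation_L2_norm H"
    unfolding eq by (intro nn_integral_Minkowski_L2 meas G H)
  finally show ?thesis .
qed

text \<open>The integral of \<open>(t / l) powr (2 * \<gamma>)\<close> for dt/t over
  \<open>t \<le> l\<close> and that of \<open>(l / t) powr (2 * \<gamma>)\<close> over
  \<open>t \<ge> l\<close> both equal \<open>1 / (2 * \<gamma>)\<close>. Hence the factor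
  \<open>sqrt (1 / \<gamma>)\<close>, free of \<open>l\<close>.\<close>

lemma dilation_L2_norm_two_sided_decay:
  assumes "0 < \<gamma>" "0 < l" "0 \<le> B"
    and small: "\<And>t. 0 < t \<Longrightarrow> t \<le> l \<Longrightarrow> cmod (F t) \<le> B * (t / l) powr \<gamma>"
    and large: "\<And>t. l \<le> t \<Longrightarrow> cmod (F t) \<le> B * (l / t) powr \<gamma>"
  shows "dilation_L2_norm F \<le> ennreal (B * sqrt (1 / \<gamma>))"
proof -
  define a b where "a = B\<^sup>2 / l powr (2 * \<gamma>)" and "b = B\<^sup>2 * l powr (2 * \<gamma>)"
  let ?f = "\<lambda>t. ennreal (t powr (2 * \<gamma> - 1)) * indicator {0..l} t"
  let ?g = "\<lambda>t. ennreal (t powr (- (2 * \<gamma>) - 1)) * indicator {l..} t"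
  have nonneg: "0 \<le> a" "0 \<le> b" by (auto simp: a_def b_def)
  have pw: "ennreal ((cmod (F t))\<^sup>2 / t) * indicator {0<..} t \<le> ennreal a * ?f t + ennreal b * ?g t" for t
  proof (cases "0 < t")
    case t: True
    have sq: "(B * (x / y) powr \<gamma>)\<^sup>2 = B\<^sup>2 * (x powr (2 * \<gamma>) / y powr (2 * \<gamma>))" if "x > 0" "y > 0" for x y
      using that by (simp add: power_mult_distrib powr_divide power_divide powr_power mult.commute)
    show ?thesis
    proof (cases "t \<le> l")
      case True
      have "(cmod (F t))\<^sup>2 / t \<le> (B * (t / l) powr \<gamma>)\<^sup>2 / t"
        using small[OF t True] t by (intro divide_right_mono power_mono) auto
      also have "\<dots> = a * t powr (2 * \<gamma> - 1)"
        using t assms by (simp add: sq powr_diff a_def)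
      finally have "ennreal ((cmod (F t))\<^sup>2 / t) * indicator {0<..} t \<le> ennreal a * ?f t"
        using t True by (simp add: ennreal_mult'[symmetric] ennreal_leI nonneg)
      then show ?thesis by (rule order_trans) simp
    next
      case False
      have "(cmod (F t))\<^sup>2 / t \<le> (B * (l / t) powr \<gamma>)\<^sup>2 / t"
        using large[of t] False t by (intro divide_right_mono power_mono) auto
      also have "\<dots> = B\<^sup>2 * (l powr (2 * \<gamma>) / t powr (2 * \<gamma>)) / t"
        by (simp only: sq[OF \<open>0 < l\<close> t])
      also have "\<dots> = b * t powr (- (2 * \<gamma>) - 1)"
        using t by (simp add: powr_diff powr_minus_divide b_def)
      finally have "ennreal ((cmod (F t))\<^sup>2 / t) * indicator {0<..} t \<le> ennreal b * ?g t"
        using t False by (simp add: ennreal_mult'[symmetric] ennreal_leI nonneg)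
      then show ?thesis by (rule order_trans) simp
    qed
  qed simp
  have f: "(\<integral>\<^sup>+t. ?f t \<partial>lborel) = ennreal (l powr (2 * \<gamma>) / (2 * \<gamma>))"
    using has_integral_powr_from_0[of "2 * \<gamma> - 1" l] assms
    by (intro nn_integral_has_integral_lebesgue') auto
  have g: "(\<integral>\<^sup>+t. ?g t \<partial>lborel) = ennreal (l powr (- (2 * \<gamma>)) / (2 * \<gamma>))"
    using has_integral_powr_to_inf[of "- (2 * \<gamma>) - 1" l] assms
    by (intro nn_integral_has_integral_lebesgue') simp_all
  have "(\<integral>\<^sup>+t\<in>{0<..}. ennreal ((cmod (F t))\<^sup>2 / t) \<partial>lebesgue)
      \<le> (\<integral>\<^sup>+t. ennreal a * ?f t + ennreal b * ?g t \<partial>lborel)"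
    unfolding nn_integral_completion by (intro nn_integral_mono pw)
  also have "\<dots> = ennreal a * ennreal (l powr (2 * \<gamma>) / (2 * \<gamma>)) + ennreal b * ennreal (l powr (- (2 * \<gamma>)) / (2 * \<gamma>))"
    by (simp add: nn_integral_add nn_integral_cmult f g)
  also have "\<dots> = ennreal (a * (l powr (2 * \<gamma>) / (2 * \<gamma>))) + ennreal (b * (l powr (- (2 * \<gamma>)) / (2 * \<gamma>)))"
    by (simp only: ennreal_mult'[OF nonneg(1)] ennreal_mult'[OF nonneg(2)])
  also have "\<dots> = ennreal (B\<^sup>2 * (1 / \<gamma>))"
    using assms by (simp add: a_def b_def ennreal_plus[symmetric] powr_minus field_simps del: ennreal_plus)
  finally have "dilation_L2_norm F \<le> enn_powr (ennreal (B\<^sup>2 * (1 / \<gamma>))) (1 / 2)"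
    unfolding dilation_L2_norm_def by (intro enn_powr_mono) auto
  also have "\<dots> = ennreal (B * sqrt (1 / \<gamma>))"
    using assms by (simp add: enn_powr_ennreal powr_half_sqrt real_sqrt_mult real_sqrt_divide)
  finally show ?thesis .
qed

section \<open>Integrals of functions with polynomial decay\<close>

lemma nn_integral_powr_decay_real:
  assumes "1 < \<beta>"
  shows "(\<integral>\<^sup>+s. ennreal ((1 + \<bar>s\<bar>) powr (- \<beta>)) \<partial>(lborel :: real measure)) < \<infinity>"
proof -
  let ?g = "\<lambda>s. ennreal (s powr (- \<beta>)) * indicator {1..} s"
  have "- (1 / (1 - \<beta>)) = 1 / (\<beta> - 1)"
    using assms by (simp add: divide_simps)
  then have g: "(\<integral>\<^sup>+s. ?g s \<partial>lborel) = ennreal (1 / (\<beta> - 1))"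
    using has_integral_powr_to_inf[of "- \<beta>" 1] assms
    by (intro nn_integral_has_integral_lebesgue') auto
  have g': "(\<integral>\<^sup>+s. ?g (- s) \<partial>lborel) = (\<integral>\<^sup>+s. ?g s \<partial>lborel)"
    by (subst (2) lborel_distr_uminus[symmetric], subst nn_integral_distr) simp_all
  have "ennreal ((1 + \<bar>s\<bar>) powr (- \<beta>)) \<le> indicator {-1..1} s + (?g s + ?g (- s))" for s :: real
  proof -
    consider "\<bar>s\<bar> \<le> 1" | "1 < s" | "s < -1" by linarith
    then show ?thesis
    proof cases
      case 1
      have "(1 + \<bar>s\<bar>) powr (- \<beta>) \<le> 1" using powr_mono2'[of "\<beta>" 1 "1 + \<bar>s\<bar>"] assms
        by (simp add: powr_minus inverse_le_1_iff ge_one_powr_ge_zero)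
      then have "ennreal ((1 + \<bar>s\<bar>) powr (- \<beta>)) \<le> indicator {-1..1} s"
        using 1 by (auto simp: indicator_def abs_le_iff)
      then show ?thesis by (rule order_trans) simp
    next
      case 2
      then show ?thesis using powr_mono2'[of "- \<beta>" s "1 + \<bar>s\<bar>"] assms
        by (auto simp: indicator_def intro!: ennreal_leI)
    next
      case 3
      then show ?thesis using powr_mono2'[of "- \<beta>" "- s" "1 + \<bar>s\<bar>"] assms
        by (auto simp: indicator_def intro!: ennreal_leI)
    qed
  qed
  then have "(\<integral>\<^sup>+s. ennreal ((1 + \<bar>s\<bar>) powr (- \<beta>)) \<partial>(lborel :: real measure))
      \<le> (\<integral>\<^sup>+s. indicator {-1..1} s + (?g s + ?g (- s)) \<partial>lborel)"
    by (intro nn_integral_mono)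
  also have "\<dots> = 2 + (ennreal (1 / (\<beta> - 1)) + ennreal (1 / (\<beta> - 1)))"
    by (simp add: nn_integral_add g' g)
  also have "\<dots> < \<infinity>" by (auto simp: less_top)
  finally show ?thesis .
qed

text \<open>The exponent is shared equally among the coordinates: \<open>norm u\<close> dominates
  every coordinate, so the integrand is at most a product of one-dimensional ones with exponent
  \<open>\<beta> > 1\<close>.\<close>

lemma nn_integral_powr_decay:
  assumes "real DIM('a::euclidean_space) < \<alpha>"
  shows "(\<integral>\<^sup>+u. ennreal ((1 + norm u) powr (- \<alpha>)) \<partial>(lborel :: 'a measure)) < \<infinity>"
proof -
  define \<beta> where "\<beta> = \<alpha> / real DIM('a)"
  have \<beta>: "1 < \<beta>" "\<alpha> = real DIM('a) * \<beta>" using assms by (simp_all add: \<beta>_def)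
  have "(1 + norm u) powr (- \<alpha>) \<le> (\<Prod>b\<in>Basis. (1 + \<bar>u \<bullet> b\<bar>) powr (- \<beta>))" for u :: 'a
  proof -
    have "(1 + norm u) powr (- \<alpha>) = (\<Prod>b\<in>(Basis::'a set). (1 + norm u) powr (- \<beta>))"
      using norm_ge_zero[of u] by (simp add: \<beta>(2) powr_power powr_realpow[symmetric] powr_powr mult.commute
          add_pos_nonneg del: norm_ge_zero)
    also have "\<dots> \<le> (\<Prod>b\<in>Basis. (1 + \<bar>u \<bullet> b\<bar>) powr (- \<beta>))"
      using \<beta> by (intro prod_mono conjI powr_mono2' add_left_mono Basis_le_norm) auto
    finally show ?thesis .
  qed
  then have "(\<integral>\<^sup>+u. ennreal ((1 + norm u) powr (- \<alpha>)) \<partial>(lborel :: 'a measure))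
     \<le> (\<integral>\<^sup>+u. (\<Prod>b\<in>Basis. ennreal ((1 + \<bar>u \<bullet> b\<bar>) powr (- \<beta>))) \<partial>(lborel :: 'a measure))"
    by (intro nn_integral_mono) (simp add: prod_ennreal ennreal_leI)
  also have "\<dots> = (\<Prod>b\<in>(Basis::'a set). \<integral>\<^sup>+s. ennreal ((1 + \<bar>s\<bar>) powr (- \<beta>)) \<partial>lborel)"
    by (rule nn_integral_lborel_prod) auto
  also have "\<dots> < \<infinity>"
    using nn_integral_powr_decay_real[OF \<beta>(1)] by (simp add: power_less_top_ennreal)
  finally show ?thesis .
qed

lemma nn_integral_dilate:
  fixes f :: "'a::euclidean_space \<Rightarrow> ennreal"
  assumes [measurable]: "f \<in> borel_measurable borel" and "0 < t"
  shows "(\<integral>\<^sup>+z. f z \<partial>lborel) = ennreal (t ^ DIM('a)) * (\<integral>\<^sup>+u. f (x + t *\<^sub>R u) \<partial>lborel)"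
  using \<open>0 < t\<close>
  by (subst lborel_affine[of t x]) (simp_all add: nn_integral_density nn_integral_distr nn_integral_cmult)

text \<open>Any constant \<open>c\<close> may stand in for the average at the cost of a factor 2,
  since the distance of the average from \<open>c\<close> is at most the mean of
  \<open>\<bar>g x - c\<bar>\<close>.\<close>

lemma mean_oscillation_le:
  fixes g :: "'a::euclidean_space \<Rightarrow> real"
  assumes Q: "Q \<in> sets lebesgue" "0 < measure lebesgue Q" "emeasure lebesgue Q < \<infinity>"
    and g: "set_integrable lebesgue Q g"
    and "0 \<le> B"
    and le: "(\<integral>\<^sup>+x\<in>Q. ennreal \<bar>g x - c\<bar> \<partial>lebesgue) \<le> ennreal (B * measure lebesgue Q)"
  shows "average Q (\<lambda>x. \<bar>g x - average Q g\<bar>) \<le> 2 * B"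
proof -
  let ?m = "measure lebesgue Q" and ?A = "average Q g"
  have const: "set_integrable lebesgue Q (\<lambda>_. d)" for d :: real
    using Q by (auto simp: set_integrable_def)
  have int_const: "(LINT x:Q|lebesgue. d) = d * ?m" for d :: real
    using Q by (simp add: set_lebesgue_integral_def)
  have gc: "set_integrable lebesgue Q (\<lambda>x. g x - d)" for d
    using g const by (rule set_integral_diff)
  have gca: "set_integrable lebesgue Q (\<lambda>x. \<bar>g x - d\<bar>)" for d
    using set_integrable_abs[OF gc] .
  have "ennreal (LINT x:Q|lebesgue. \<bar>g x - c\<bar>) = (\<integral>\<^sup>+x\<in>Q. ennreal \<bar>g x - c\<bar> \<partial>lebesgue)"
    using gca[of c] unfolding set_lebesgue_integral_def set_integrable_def
    by (subst nn_integral_eq_integral[symmetric]) (auto intro!: nn_integral_cong simp: indicator_def)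
  with le have "ennreal (LINT x:Q|lebesgue. \<bar>g x - c\<bar>) \<le> ennreal (B * ?m)"
    by simp
  then have L: "(LINT x:Q|lebesgue. \<bar>g x - c\<bar>) \<le> B * ?m"
    using \<open>0 \<le> B\<close> by (subst (asm) ennreal_le_iff) auto
  have "?m * (?A - c) = (LINT x:Q|lebesgue. g x - c)"
    using Q g const by (simp add: set_integral_diff int_const average_def right_diff_distrib mult.commute)
  also have "\<bar>\<dots>\<bar> \<le> (LINT x:Q|lebesgue. \<bar>g x - c\<bar>)"
    using set_integral_norm_bound[OF gc] by simp
  finally have Ac: "?m * \<bar>?A - c\<bar> \<le> B * ?m"
    using L Q(2) by (simp only: abs_mult)
  have "(LINT x:Q|lebesgue. \<bar>g x - ?A\<bar>) \<le> (LINT x:Q|lebesgue. \<bar>g x - c\<bar> + \<bar>?A - c\<bar>)"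
    by (intro set_integral_mono gca set_integral_add const) auto
  also have "\<dots> = (LINT x:Q|lebesgue. \<bar>g x - c\<bar>) + \<bar>?A - c\<bar> * ?m"
    using gca const by (simp add: set_integral_add int_const)
  also have "\<dots> \<le> 2 * B * ?m"
    using L Ac by (simp add: algebra_simps)
  finally show ?thesis
    using Q by (simp add: average_def divide_le_eq)
qed

lemma cmod_integral_le_nn_integral:
  fixes G :: "'a \<Rightarrow> complex"
  assumes "\<And>y. cmod (G y) \<le> F y" and "(\<integral>\<^sup>+y. ennreal (F y) \<partial>M) \<le> ennreal c" and "0 \<le> c"
  shows "cmod (LINT y|M. G y) \<le> c"
proof (cases "integrable M G")
  case True
  have "ennreal (cmod (LINT y|M. G y)) \<le> (\<integral>\<^sup>+y. ennreal (cmod (G y)) \<partial>M)"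
    using True by (rule integral_norm_bound_ennreal)
  also have "\<dots> \<le> (\<integral>\<^sup>+y. ennreal (F y) \<partial>M)"
    using assms(1) by (intro nn_integral_mono ennreal_leI)
  also note assms(2)
  finally show ?thesis
    using \<open>0 \<le> c\<close> by (simp add: ennreal_le_iff)
\<comment> \<open>A function that is not integrable has integral 0 by convention, and the claim is
  then \<open>0 \<le> c\<close>.\<close>
qed (simp add: not_integrable_integral_eq assms)

lemma continuous_on_Hoelder:
  fixes f :: "'a::real_normed_vector \<Rightarrow> 'b::metric_space"
  assumes "0 < \<gamma>" and le: "\<And>x y. dist (f x) (f y) \<le> c * norm (x - y) powr \<gamma>"
  shows "continuous_on UNIV f"
proof -
  have "(f \<longlongrightarrow> f x) (at x)" for x
  proof -
    have "((\<lambda>y. c * norm (y - x) powr \<gamma>) \<longlongrightarrow> c * norm (x - x) powr \<gamma>) (at x)"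
      using \<open>0 < \<gamma>\<close> by (intro tendsto_intros) (auto simp: eventually_at_filter)
    then have "((\<lambda>y. c * norm (y - x) powr \<gamma>) \<longlongrightarrow> 0) (at x)"
      by simp
    then show ?thesis
      by (subst tendsto_dist_iff, rule tendsto_sandwich[rotated 3, OF _ _ _ tendsto_const])
        (auto simp: le)
  qed
  then show ?thesis
    by (simp add: continuous_on_def)
qed

lemma sigma_finite_lebesgue: "sigma_finite_measure (lebesgue :: 'a::euclidean_space measure)"
proof
  obtain A :: "'a set set" where "countable A" "A \<subseteq> sets lborel" "\<Union> A = UNIV"
      "\<forall>a\<in>A. emeasure lborel a \<noteq> \<infinity>"
    using lborel.sigma_finite_countable by auto
  then show "\<exists>A::'a set set. countable A \<and> A \<subseteq> sets lebesgue \<and> \<Union> A = space lebesgue \<and>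
      (\<forall>a\<in>A. emeasure lebesgue a \<noteq> \<infinity>)"
    by (intro exI[of _ A]) (auto simp: subset_iff main_part_sets)
qed

text \<open>The measurability half of Tonelli: joint measurability in \<open>(t, x)\<close> survives
  integration over \<open>t\<close>.\<close>

lemma borel_measurable_dilation_L2_norm:
  assumes "(\<lambda>(t, x). F t x) \<in> borel_measurable (lebesgue_on {0<..} \<Otimes>\<^sub>M M)"
  shows "(\<lambda>x. dilation_L2_norm (\<lambda>t. F t x)) \<in> borel_measurable M"
proof -
  interpret sigma_finite_measure "lebesgue_on {0<..} :: real measure"
    by (intro sigma_finite_measure_restrict_space sigma_finite_lebesgue) auto
  have id: "(\<lambda>t::real. t) \<in> borel_measurable (lebesgue_on {0<..})"
    using id_borel_measurable_lebesgue_on by (simp add: id_def)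
  have [measurable]: "(\<lambda>p::real \<times> _. fst p) \<in> borel_measurable (lebesgue_on {0<..} \<Otimes>\<^sub>M M)"
    by (rule measurable_compose[OF measurable_fst id])
  have [measurable]: "(\<lambda>p. F (fst p) (snd p)) \<in> borel_measurable (lebesgue_on {0<..} \<Otimes>\<^sub>M M)"
    using assms by (simp add: case_prod_unfold)
  have m: "(\<lambda>p. ennreal ((cmod (F (fst p) (snd p)))\<^sup>2 / fst p))
      \<in> borel_measurable (lebesgue_on {0<..} \<Otimes>\<^sub>M M)"
    by measurable
  have "(\<lambda>x. \<integral>\<^sup>+t. ennreal ((cmod (F t x))\<^sup>2 / t) \<partial>lebesgue_on {0<..}) \<in> borel_measurable M"
    using measurable_compose[OF measurable_pair_swap' m]
    by (intro borel_measurable_nn_integral) (simp add: case_prod_unfold)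
  then show ?thesis
    unfolding dilation_L2_norm_def
    by (intro measurable_compose[OF _ measurable_enn_powr])
      (simp add: nn_integral_restrict_space)
qed

section \<open>Kernel estimates\<close>

locale square_function_kernel =
  fixes \<theta> :: "real \<Rightarrow> real^'n \<Rightarrow> real^'n^'m \<Rightarrow> complex" and N \<gamma> A :: real
  assumes measurable_kernel: "\<And>x y. (\<lambda>t. \<theta> t x y) \<in> borel_measurable (lebesgue_on {0<..})"
    and N: "real CARD('n) < N"
    and \<gamma>: "0 < \<gamma>" "\<gamma> \<le> 1"
    and A: "0 < A"
    and size: "\<And>t x y. 0 < t \<Longrightarrow> cmod (\<theta> t x y) \<le> A * kernel_majorant N \<gamma> t x y"
    and regular_y: "\<And>t x y i z. 0 < t \<Longrightarrow> cmod (\<theta> t x y - \<theta> t x (replace_component y i z))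
        \<le> A * (norm (y $ i - z) / t) powr \<gamma> * kernel_majorant N \<gamma> t x y"
    and regular_x: "\<And>t x x' y. 0 < t \<Longrightarrow> cmod (\<theta> t x y - \<theta> t x' y)
        \<le> A * (norm (x - x') / t) powr \<gamma> * kernel_majorant N \<gamma> t x y"
begin

section \<open>The majorant as a product of one-variable weights\<close>

abbreviation majorant :: "real \<Rightarrow> real^'n \<Rightarrow> real^'n^'m \<Rightarrow> real" where
  "majorant \<equiv> kernel_majorant N \<gamma>"

definition weight :: "real \<Rightarrow> real^'n \<Rightarrow> real^'n \<Rightarrow> real" where
  "weight t x z = t powr (- real CARD('n)) * (1 + norm (x - z) / t) powr (- (N + \<gamma>))"

text \<open>The exponent is \<open>N\<close>, not \<open>N + \<gamma>\<close>: this part alone is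
  integrable, and the remaining factor with exponent \<open>- \<gamma>\<close> is free to measure
  the distance from \<open>x\<close>.\<close>

definition mass :: real where
  "mass = enn2real (\<integral>\<^sup>+u. ennreal ((1 + norm u) powr (- N)) \<partial>(lborel :: (real^'n) measure))"

lemma weight_nonneg: "0 \<le> weight t x z"
  by (simp add: weight_def)

lemma mass_nonneg: "0 \<le> mass"
  by (simp add: mass_def)

lemma ennreal_mass:
  "ennreal mass = (\<integral>\<^sup>+u. ennreal ((1 + norm u) powr (- N)) \<partial>(lborel :: (real^'n) measure))"
  using nn_integral_powr_decay[of N, where 'a = "real^'n"] N by (simp add: mass_def)

lemma measurable_weight [measurable]: "weight t x \<in> borel_measurable borel"
  unfolding weight_def[abs_def] by measurable

lemma kernel_majorant_eq_prod:
  assumes "0 < t"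
  shows "majorant t x y = (\<Prod>j\<in>UNIV. weight t x (y $ j))"
proof -
  have "t powr (- real (CARD('m) * CARD('n))) = (\<Prod>j\<in>(UNIV::'m set). t powr (- real CARD('n)))"
    using assms by (simp add: powr_power mult.commute)
  moreover have "weight t x z = t powr (- real CARD('n)) / (1 + norm (x - z) / t) powr (N + \<gamma>)" for z
    unfolding weight_def powr_minus_divide[of _ "N + \<gamma>"] by simp
  ultimately show ?thesis
    by (simp only: kernel_majorant_def prod_dividef)
qed

lemma kernel_majorant_nonneg: "0 \<le> majorant t x y"
  unfolding kernel_majorant_def by (intro divide_nonneg_nonneg prod_nonneg) auto

lemma kernel_majorant_le:
  assumes "0 < t"
  shows "majorant t x y \<le> t powr (- real (CARD('m) * CARD('n)))"
proof -
  have "1 \<le> (\<Prod>j\<in>(UNIV::'m set). (1 + norm (x - y $ j) / t) powr (N + \<gamma>))"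
    using assms N \<gamma> by (intro prod_ge_1 ge_one_powr_ge_zero) auto
  then show ?thesis
    unfolding kernel_majorant_def by (simp add: divide_le_eq mult_left_mono mult_le_cancel_left1)
qed

lemma measurable_kernel_majorant [measurable]: "majorant t x \<in> borel_measurable borel"
  unfolding kernel_majorant_def[abs_def] by measurable

text \<open>Bound the factor with exponent \<open>- \<gamma>\<close> by \<open>c\<close> on
  \<open>S\<close> and substitute \<open>z = x + t *\<^sub>R u\<close> in what is left; the powers
  of \<open>t\<close> cancel. The cases \<open>c = 1\<close> and
  \<open>c = (t / l) powr \<gamma>\<close> are the total and the tail estimate.\<close>

lemma nn_integral_weight_restricted:
  assumes "0 < t" "0 \<le> c" and S: "\<And>z. z \<in> S \<Longrightarrow> (1 + norm (x - z) / t) powr (- \<gamma>) \<le> c"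
  shows "(\<integral>\<^sup>+z. ennreal (weight t x z) * indicator S z \<partial>lborel) \<le> ennreal (mass * c)"
proof -
  let ?w = "\<lambda>z. t powr (- real CARD('n)) * (1 + norm (x - z) / t) powr (- N)"
  have "ennreal (weight t x z) * indicator S z \<le> ennreal c * ennreal (?w z)" for z
  proof (cases "z \<in> S")
    case True
    have "weight t x z = ?w z * (1 + norm (x - z) / t) powr (- \<gamma>)"
      by (simp add: weight_def powr_add[symmetric])
    also have "\<dots> \<le> ?w z * c"
      using S[OF True] by (intro mult_left_mono) auto
    finally show ?thesis
      using True \<open>0 \<le> c\<close> by (simp add: ennreal_mult'[symmetric] ennreal_leI mult.commute)
  qed simp
  then have "(\<integral>\<^sup>+z. ennreal (weight t x z) * indicator S z \<partial>lborel)
      \<le> (\<integral>\<^sup>+z. ennreal c * ennreal (?w z) \<partial>lborel)"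
    by (intro nn_integral_mono)
  also have "\<dots> = ennreal c * (\<integral>\<^sup>+z. ennreal (?w z) \<partial>lborel)"
    by (rule nn_integral_cmult) simp
  also have "(\<integral>\<^sup>+z. ennreal (?w z) \<partial>lborel)
      = ennreal (t ^ CARD('n)) * (\<integral>\<^sup>+u. ennreal (?w (x + t *\<^sub>R u)) \<partial>lborel)"
    using nn_integral_dilate[of "\<lambda>z. ennreal (?w z)" t x] \<open>0 < t\<close> by simp
  also have "\<dots> = (\<integral>\<^sup>+u. ennreal (t ^ CARD('n)) * ennreal (?w (x + t *\<^sub>R u)) \<partial>lborel)"
    by (rule nn_integral_cmult[symmetric]) simp
  also have "\<dots> = ennreal mass"
    unfolding ennreal_mass
    using \<open>0 < t\<close> by (intro nn_integral_cong)
      (simp add: ennreal_mult'[symmetric] powr_minus powr_realpow)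
  finally show ?thesis
    using \<open>0 \<le> c\<close> mass_nonneg by (simp add: ennreal_mult'[symmetric] mult.commute)
qed

lemma nn_integral_weight:
  assumes "0 < t"
  shows "(\<integral>\<^sup>+z. ennreal (weight t x z) \<partial>lborel) \<le> ennreal mass"
proof -
  have "(1 + norm (x - z) / t) powr (- \<gamma>) \<le> 1" for z
    using powr_mono2'[of "- \<gamma>" 1 "1 + norm (x - z) / t"] assms \<gamma> by simp
  then show ?thesis
    using nn_integral_weight_restricted[of t 1 UNIV x] assms by simp
qed

lemma nn_integral_weight_tail:
  assumes "0 < t" "0 < l"
  shows "(\<integral>\<^sup>+z. ennreal (weight t x z) * indicator {z. l \<le> norm (x - z)} z \<partial>lborel)
      \<le> ennreal (mass * (t / l) powr \<gamma>)"
proof (rule nn_integral_weight_restricted)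
  fix z assume "z \<in> {z. l \<le> norm (x - z)}"
  then have "l / t \<le> 1 + norm (x - z) / t"
    using assms by (auto simp: divide_simps)
  then have "(1 + norm (x - z) / t) powr (- \<gamma>) \<le> (l / t) powr (- \<gamma>)"
    using assms \<gamma> by (intro powr_mono2') auto
  also have "\<dots> = (t / l) powr \<gamma>"
    using assms by (simp add: powr_minus powr_divide)
  finally show "(1 + norm (x - z) / t) powr (- \<gamma>) \<le> (t / l) powr \<gamma>" .
qed (use assms in auto)

lemma nn_integral_kernel_majorant:
  assumes "0 < t"
  shows "(\<integral>\<^sup>+y. ennreal (majorant t x y) \<partial>lborel) \<le> ennreal (mass ^ CARD('m))"
proof -
  have "(\<integral>\<^sup>+y. ennreal (majorant t x y) \<partial>lborel)
      = (\<integral>\<^sup>+y. (\<Prod>j\<in>(UNIV::'m set). ennreal (weight t x (y $ j))) \<partial>lborel)"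
    using assms by (simp add: kernel_majorant_eq_prod prod_ennreal weight_nonneg)
  also have "\<dots> = (\<Prod>j\<in>(UNIV::'m set). \<integral>\<^sup>+z. ennreal (weight t x z) \<partial>lborel)"
    by (rule nn_integral_prod_vec) simp
  also have "\<dots> \<le> (\<Prod>j\<in>(UNIV::'m set). ennreal mass)"
    using nn_integral_weight[OF assms] by (intro prod_mono_ennreal)
  also have "\<dots> = ennreal (mass ^ CARD('m))"
    by (simp add: ennreal_power mass_nonneg)
  finally show ?thesis .
qed

text \<open>A union bound over the component that is far from \<open>x\<close>: each of the
  \<open>CARD('m)\<close> terms gains \<open>(t / l) powr \<gamma>\<close> from one factor and
  contributes at most \<open>mass\<close> from every other factor.\<close>

lemma nn_integral_kernel_majorant_tail:
  assumes t: "0 < t" and l: "0 < l" and S: "\<And>y. y \<in> S \<Longrightarrow> \<exists>j. l \<le> norm (x - y $ j)"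
  shows "(\<integral>\<^sup>+y. ennreal (majorant t x y) * indicator S y \<partial>lborel)
      \<le> ennreal (real CARD('m) * mass ^ CARD('m) * (t / l) powr \<gamma>)"
proof -
  let ?S = "{z. l \<le> norm (x - z)}"
  define w where "w j k z = ennreal (weight t x z) * (if k = j then indicator ?S z else 1)"
    for j k :: 'm and z
  have w [measurable]: "w j k \<in> borel_measurable borel" for j k
    unfolding w_def by measurable
  have prod_w: "(\<Prod>k\<in>UNIV. w j k (y $ k)) = ennreal (majorant t x y) * indicator ?S (y $ j)"
    for j and y :: "real^'n^'m"
    using t by (simp add: w_def prod.distrib kernel_majorant_eq_prod prod_ennreal weight_nonneg)
  have int_w: "(\<integral>\<^sup>+z. w j k z \<partial>lborel) \<le> ennreal (mass * (if k = j then (t / l) powr \<gamma> else 1))" for j k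
    using nn_integral_weight[OF t, of x] nn_integral_weight_tail[OF t l, of x]
    by (auto simp: w_def)
  have "ennreal (majorant t x y) * indicator S y \<le> (\<Sum>j\<in>UNIV. \<Prod>k\<in>UNIV. w j k (y $ k))" for y
  proof (cases "y \<in> S")
    case True
    then obtain j where "y $ j \<in> ?S" using S by auto
    then have "ennreal (majorant t x y) * indicator S y = (\<Prod>k\<in>UNIV. w j k (y $ k))"
      using True by (simp add: prod_w)
    also have "\<dots> \<le> (\<Sum>j\<in>UNIV. \<Prod>k\<in>UNIV. w j k (y $ k))"
      by (rule member_le_sum) auto
    finally show ?thesis .
  qed simp
  then have "(\<integral>\<^sup>+y. ennreal (majorant t x y) * indicator S y \<partial>lborel)
      \<le> (\<integral>\<^sup>+y. (\<Sum>j\<in>UNIV. \<Prod>k\<in>UNIV. w j k (y $ k)) \<partial>lborel)"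
    by (intro nn_integral_mono)
  also have "\<dots> = (\<Sum>j\<in>UNIV. \<Prod>k\<in>UNIV. \<integral>\<^sup>+z. w j k z \<partial>lborel)"
    by (subst nn_integral_sum) (auto simp: nn_integral_prod_vec)
  also have "\<dots> \<le> (\<Sum>j\<in>(UNIV::'m set). \<Prod>k\<in>UNIV. ennreal (mass * (if k = j then (t / l) powr \<gamma> else 1)))"
    by (intro sum_mono prod_mono_ennreal int_w)
  also have "\<dots> = (\<Sum>j\<in>(UNIV::'m set). ennreal (mass ^ CARD('m) * (t / l) powr \<gamma>))"
    using mass_nonneg by (subst prod_ennreal) (auto simp: prod.distrib)
  also have "\<dots> = ennreal (real CARD('m) * mass ^ CARD('m) * (t / l) powr \<gamma>)"
    by (simp add: sum_ennreal mass_nonneg ennreal_of_nat_eq_real_of_nat ennreal_mult'[symmetric] mult.assoc)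
  finally show ?thesis .
qed

text \<open>The components are exchanged one at a time, each at the price given by
  \<open>regular_y\<close>. Only continuity in \<open>y\<close> for fixed \<open>t\<close> is wanted
  from it, so the majorant is replaced by its crude upper bound, a power of
  \<open>t\<close>.\<close>

lemma kernel_Hoelder:
  assumes t: "0 < t"
  defines "c \<equiv> A * t powr (- real (CARD('m) * CARD('n))) / t powr \<gamma>"
  shows "cmod (\<theta> t x y - \<theta> t x y') \<le> real CARD('m) * c * norm (y - y') powr \<gamma>"
proof -
  \<comment> \<open>\<open>v S\<close> interpolates between \<open>y\<close> (for \<open>S\<close>
    empty) and \<open>y'\<close> (for \<open>S = UNIV\<close>).\<close>
  define v where "v S = (\<chi> j. if j \<in> S then y' $ j else y $ j)" for S
  have "cmod (\<theta> t x y - \<theta> t x (v S)) \<le> real (card S) * c * norm (y - y') powr \<gamma>" for S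
  proof (induction S rule: finite_induct[OF finite])
    case 1
    have "v {} = y" by (simp add: v_def vec_eq_iff)
    then show ?case by simp
  next
    case (2 i S)
    have "v (insert i S) = replace_component (v S) i (y' $ i)"
      by (auto simp: v_def replace_component_def vec_eq_iff)
    then have "cmod (\<theta> t x (v S) - \<theta> t x (v (insert i S)))
        \<le> A * (norm (v S $ i - y' $ i) / t) powr \<gamma> * majorant t x (v S)"
      using regular_y[OF t] by simp
    also have "\<dots> \<le> A * (norm (y - y') / t) powr \<gamma> * t powr (- real (CARD('m) * CARD('n)))"
    proof (intro mult_mono kernel_majorant_le mult_left_mono powr_mono2 divide_right_mono)
      show "norm (v S $ i - y' $ i) \<le> norm (y - y')"
        using 2 Finite_Cartesian_Product.norm_nth_le[of "y - y'" i] by (simp add: v_def)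
    qed (use t A \<gamma> in \<open>auto simp: kernel_majorant_nonneg\<close>)
    also have "\<dots> = c * norm (y - y') powr \<gamma>"
      using t by (simp add: c_def powr_divide)
    finally have "cmod (\<theta> t x (v S) - \<theta> t x (v (insert i S))) \<le> c * norm (y - y') powr \<gamma>" .
    then have "cmod (\<theta> t x y - \<theta> t x (v (insert i S)))
        \<le> real (card S) * c * norm (y - y') powr \<gamma> + c * norm (y - y') powr \<gamma>"
      using "2.IH" norm_triangle_le[of "\<theta> t x y - \<theta> t x (v S)" "\<theta> t x (v S) - \<theta> t x (v (insert i S))"]
      by simp
    then show ?case
      using 2 by (simp add: algebra_simps)
  qed
  from this[of UNIV] show ?thesis
    by (simp add: v_def)
qed

section \<open>Continuity and measurability of the kernel\<close>

lemma continuous_kernel: "0 < t \<Longrightarrow> continuous_on UNIV (\<theta> t x)"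
  unfolding dist_norm[symmetric]
  by (rule continuous_on_Hoelder[OF \<gamma>(1)]) (unfold dist_norm, rule kernel_Hoelder)

lemma borel_measurable_kernel: "0 < t \<Longrightarrow> \<theta> t x \<in> borel_measurable borel"
  by (intro borel_measurable_continuous_onI continuous_kernel)

lemma measurable_kernel_pair:
  "(\<lambda>(t, y). \<theta> t x y) \<in> borel_measurable (lebesgue_on {0<..} \<Otimes>\<^sub>M borel)"
  using measurable_kernel continuous_kernel
  by (intro borel_measurable_Caratheodory) (auto simp: space_restrict_space)

text \<open>The operator acts on a function \<open>h\<close> of all variables instead of a tuple,
  because the product minus its local part is in general not a product of functions of the single
  components.\<close>

definition kernel_integral :: "(real^'n^'m \<Rightarrow> complex) \<Rightarrow> real \<Rightarrow> real^'n \<Rightarrow> complex" where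
  "kernel_integral h t x = (LINT y|lborel. \<theta> t x y * h y)"

section \<open>Bounds for integrals against the kernel\<close>

lemma integrable_kernel_mult:
  assumes [measurable]: "h \<in> borel_measurable borel" and h: "\<And>y. cmod (h y) \<le> P" and t: "0 < t"
  shows "integrable lborel (\<lambda>y. \<theta> t x y * h y)"
proof (rule integrableI_bounded)
  note borel_measurable_kernel[OF t, measurable]
  show "(\<lambda>y. \<theta> t x y * h y) \<in> borel_measurable lborel" by measurable
  have P: "0 \<le> P" using h[of undefined] norm_ge_zero[of "h undefined"] by linarith
  have "(\<integral>\<^sup>+y. ennreal (norm (\<theta> t x y * h y)) \<partial>lborel)
      \<le> (\<integral>\<^sup>+y. ennreal (A * P) * ennreal (majorant t x y) \<partial>lborel)"
  proof (intro nn_integral_mono)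
    fix y
    have "cmod (\<theta> t x y * h y) \<le> (A * majorant t x y) * P"
      unfolding norm_mult using size[OF t] h A
      by (intro mult_mono) (auto simp: kernel_majorant_nonneg)
    then show "ennreal (norm (\<theta> t x y * h y)) \<le> ennreal (A * P) * ennreal (majorant t x y)"
      using A P by (simp add: ennreal_mult'[symmetric] mult_ac ennreal_leI)
  qed
  also have "\<dots> = ennreal (A * P) * (\<integral>\<^sup>+y. ennreal (majorant t x y) \<partial>lborel)"
    by (rule nn_integral_cmult) simp
  also have "\<dots> < \<infinity>"
    using nn_integral_kernel_majorant[OF t, of x]
    by (simp add: ennreal_mult_less_top order_le_less_trans[OF _ ennreal_less_top])
  finally show "(\<integral>\<^sup>+y. ennreal (norm (\<theta> t x y * h y)) \<partial>lborel) < \<infinity>" .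
qed

lemma kernel_integral_diff:
  assumes "h \<in> borel_measurable borel" "\<And>y. cmod (h y) \<le> P"
    and "h' \<in> borel_measurable borel" "\<And>y. cmod (h' y) \<le> P'" and "0 < t"
  shows "kernel_integral (\<lambda>y. h y - h' y) t x = kernel_integral h t x - kernel_integral h' t x"
  unfolding kernel_integral_def
  using integrable_kernel_mult[OF assms(1,2,5)] integrable_kernel_mult[OF assms(3,4,5)]
  by (simp add: right_diff_distrib)

text \<open>Integrate \<open>regular_x\<close> against the majorant. It serves twice: as the decay
  for \<open>t\<close> above the side of the cube, and as continuity in \<open>x\<close> for the
  measurability of the square function.\<close>

lemma kernel_integral_regular:
  assumes "h \<in> borel_measurable borel" and h: "\<And>y. cmod (h y) \<le> P" and t: "0 < t"
  shows "cmod (kernel_integral h t x - kernel_integral h t x')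
      \<le> A * P * mass ^ CARD('m) * (norm (x - x') / t) powr \<gamma>"
proof -
  have P: "0 \<le> P" using h[of undefined] norm_ge_zero[of "h undefined"] by linarith
  let ?c = "A * P * (norm (x - x') / t) powr \<gamma>"
  have c: "0 \<le> ?c" using A P by simp
  have "kernel_integral h t x - kernel_integral h t x' = (LINT y|lborel. (\<theta> t x y - \<theta> t x' y) * h y)"
    unfolding kernel_integral_def using integrable_kernel_mult[OF assms]
    by (simp add: left_diff_distrib)
  also have "cmod \<dots> \<le> ?c * mass ^ CARD('m)"
  proof (rule cmod_integral_le_nn_integral)
    show "cmod ((\<theta> t x y - \<theta> t x' y) * h y) \<le> ?c * majorant t x y" for y
    proof -
      have "cmod ((\<theta> t x y - \<theta> t x' y) * h y)
          \<le> (A * (norm (x - x') / t) powr \<gamma> * majorant t x y) * P"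
        unfolding norm_mult using regular_x[OF t] h A
        by (intro mult_mono) (auto simp: kernel_majorant_nonneg)
      then show ?thesis by (simp add: mult_ac)
    qed
    have "(\<integral>\<^sup>+y. ennreal (?c * majorant t x y) \<partial>lborel)
        = ennreal ?c * (\<integral>\<^sup>+y. ennreal (majorant t x y) \<partial>lborel)"
      by (subst ennreal_mult'[OF c]) (rule nn_integral_cmult, simp)
    also have "\<dots> \<le> ennreal ?c * ennreal (mass ^ CARD('m))"
      by (intro mult_left_mono nn_integral_kernel_majorant t) simp
    finally show "(\<integral>\<^sup>+y. ennreal (?c * majorant t x y) \<partial>lborel) \<le> ennreal (?c * mass ^ CARD('m))"
      by (subst ennreal_mult'[OF c])
  qed (use c mass_nonneg in auto)
  finally show ?thesis by (simp add: mult_ac)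
qed

text \<open>The decay for \<open>t\<close> below the side of the cube. On the support of
  \<open>h\<close> some component, depending on \<open>y\<close>, is far from \<open>x\<close>,
  which is exactly the set of the majorant tail estimate.\<close>

lemma kernel_integral_tail:
  assumes h: "\<And>y. cmod (h y) \<le> P" and t: "0 < t" and l: "0 < l"
    and supp: "\<And>y. h y \<noteq> 0 \<Longrightarrow> \<exists>j. l \<le> norm (x - y $ j)"
  shows "cmod (kernel_integral h t x) \<le> A * P * (real CARD('m) * mass ^ CARD('m) * (t / l) powr \<gamma>)"
  unfolding kernel_integral_def
proof (rule cmod_integral_le_nn_integral)
  have P: "0 \<le> P" using h[of undefined] norm_ge_zero[of "h undefined"] by linarith
  have c: "0 \<le> A * P" using A P by simp
  let ?S = "{y::real^'n^'m. \<exists>j. l \<le> norm (x - y $ j)}"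
  have S: "?S \<in> sets borel" by measurable
  show "cmod (\<theta> t x y * h y) \<le> A * P * (majorant t x y * indicator ?S y)" for y
  proof (cases "h y = 0")
    case False
    then have "indicator ?S y = (1::real)" using supp by (simp add: indicator_def)
    moreover have "cmod (\<theta> t x y * h y) \<le> (A * majorant t x y) * P"
      unfolding norm_mult using size[OF t] h A
      by (intro mult_mono) (auto simp: kernel_majorant_nonneg)
    ultimately show ?thesis by (simp add: mult_ac)
  qed (simp add: c kernel_majorant_nonneg)
  have "(\<integral>\<^sup>+y. ennreal (A * P * (majorant t x y * indicator ?S y)) \<partial>lborel)
      = (\<integral>\<^sup>+y. ennreal (A * P) * (ennreal (majorant t x y) * indicator ?S y) \<partial>lborel)"
    by (intro nn_integral_cong) (simp add: ennreal_mult'[OF c] indicator_def)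
  also have "\<dots> = ennreal (A * P) * (\<integral>\<^sup>+y. ennreal (majorant t x y) * indicator ?S y \<partial>lborel)"
    using S by (intro nn_integral_cmult) measurable
  also have "\<dots> \<le> ennreal (A * P) * ennreal (real CARD('m) * mass ^ CARD('m) * (t / l) powr \<gamma>)"
    by (intro mult_left_mono nn_integral_kernel_majorant_tail t l) auto
  finally show "(\<integral>\<^sup>+y. ennreal (A * P * (majorant t x y * indicator ?S y)) \<partial>lborel)
      \<le> ennreal (A * P * (real CARD('m) * mass ^ CARD('m) * (t / l) powr \<gamma>))"
    by (subst ennreal_mult'[OF c])
  show "0 \<le> A * P * (real CARD('m) * mass ^ CARD('m) * (t / l) powr \<gamma>)"
    using c mass_nonneg by simp
qed

lemma measurable_kernel_integral:
  assumes [measurable]: "h \<in> borel_measurable borel"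
  shows "(\<lambda>t. kernel_integral h t x) \<in> borel_measurable (lebesgue_on {0<..})"
proof -
  have "(\<lambda>p. \<theta> (fst p) x (snd p)) \<in> borel_measurable (lebesgue_on {0<..} \<Otimes>\<^sub>M borel)"
    using measurable_kernel_pair[of x] by (simp add: case_prod_unfold)
  then have "(\<lambda>(t, y). \<theta> t x y * h y) \<in> borel_measurable (lebesgue_on {0<..} \<Otimes>\<^sub>M borel)"
    unfolding case_prod_unfold by measurable
  then have "(\<lambda>(t, y). \<theta> t x y * h y) \<in> borel_measurable (lebesgue_on {0<..} \<Otimes>\<^sub>M lborel)"
    by simp
  then show ?thesis
    unfolding kernel_integral_def by (rule lborel.borel_measurable_lebesgue_integral)
qed

lemma borel_measurable_square:
  assumes "h \<in> borel_measurable borel" and h: "\<And>y. cmod (h y) \<le> P"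
  shows "(\<lambda>x. dilation_L2_norm (\<lambda>t. kernel_integral h t x)) \<in> borel_measurable borel"
proof (intro borel_measurable_dilation_L2_norm borel_measurable_Caratheodory)
  fix t :: real assume "t \<in> space (lebesgue_on {0<..})"
  then have t: "0 < t" by (simp add: space_restrict_space)
  show "continuous_on UNIV (kernel_integral h t)"
  proof (rule continuous_on_Hoelder[OF \<gamma>(1)])
    show "dist (kernel_integral h t x) (kernel_integral h t y)
        \<le> (A * P * mass ^ CARD('m) / t powr \<gamma>) * norm (x - y) powr \<gamma>" for x y
      using kernel_integral_regular[OF assms t, of x y] t by (simp add: dist_norm powr_divide)
  qed
qed (rule measurable_kernel_integral[OF assms(1)])

text \<open>\<open>CARD('n)\<close> comes from the bound for \<open>norm (x - x')\<close> by
  \<open>CARD('n) * l\<close> when \<open>t \<ge> l\<close>, \<open>2 * CARD('m)\<close> from the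
  tail estimate at two points when \<open>t \<le> l\<close>, and \<open>sqrt (1 / \<gamma>)\<close>
  from the integration in dt/t.\<close>

definition smoothing_const :: real where
  "smoothing_const = A * mass ^ CARD('m) * (real CARD('n) + 2 * real CARD('m)) * sqrt (1 / \<gamma>)"

lemma smoothing_const_nonneg: "0 \<le> smoothing_const"
  unfolding smoothing_const_def using A mass_nonneg \<gamma> by simp

lemma far_part_oscillation:
  assumes h: "h \<in> borel_measurable borel" "\<And>y. cmod (h y) \<le> P" and l: "0 < l"
    and far: "\<And>y. h y \<noteq> 0 \<Longrightarrow> \<exists>j. l \<le> norm (x - y $ j)" "\<And>y. h y \<noteq> 0 \<Longrightarrow> \<exists>j. l \<le> norm (x' - y $ j)"
    and near: "norm (x - x') \<le> real CARD('n) * l"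
  shows "dilation_L2_norm (\<lambda>t. kernel_integral h t x - kernel_integral h t x')
      \<le> ennreal (smoothing_const * P)"
proof -
  have P: "0 \<le> P" using h(2)[of undefined] norm_ge_zero[of "h undefined"] by linarith
  let ?J = "mass ^ CARD('m)"
  let ?B = "A * P * ?J * (real CARD('n) + 2 * real CARD('m))"
  have c: "0 \<le> A * P * ?J" using A P mass_nonneg by simp
  have "dilation_L2_norm (\<lambda>t. kernel_integral h t x - kernel_integral h t x') \<le> ennreal (?B * sqrt (1 / \<gamma>))"
  proof (rule dilation_L2_norm_two_sided_decay[OF \<gamma>(1) l])
    show "0 \<le> ?B" using c by simp
    fix t :: real assume t: "0 < t"
    have "cmod (kernel_integral h t x - kernel_integral h t x')
        \<le> cmod (kernel_integral h t x) + cmod (kernel_integral h t x')"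
      by (rule norm_triangle_ineq4)
    also have "\<dots> \<le> 2 * (A * P * (real CARD('m) * ?J * (t / l) powr \<gamma>))"
      using kernel_integral_tail[of h, OF h(2) t l far(1)] kernel_integral_tail[of h, OF h(2) t l far(2)]
      by simp
    also have "\<dots> = A * P * ?J * (2 * real CARD('m)) * (t / l) powr \<gamma>" by simp
    also have "\<dots> \<le> ?B * (t / l) powr \<gamma>"
      using c by (intro mult_right_mono mult_left_mono) auto
    finally show "cmod (kernel_integral h t x - kernel_integral h t x') \<le> ?B * (t / l) powr \<gamma>" .
  next
    fix t :: real assume lt: "l \<le> t"
    then have t: "0 < t" using l by simp
    have d: "1 \<le> real CARD('n)" by (simp add: Suc_leI)
    have "(norm (x - x') / t) powr \<gamma> \<le> (real CARD('n) * (l / t)) powr \<gamma>"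
      using near t \<gamma> by (intro powr_mono2) (auto simp: divide_right_mono)
    also have "\<dots> = real CARD('n) powr \<gamma> * (l / t) powr \<gamma>"
      using l t by (subst powr_mult) auto
    \<comment> \<open>\<open>\<gamma> \<le> 1\<close> and \<open>CARD('n) \<ge> 1\<close> allow the
      exponent on the dimension to be raised to 1.\<close>
    also have "\<dots> \<le> real CARD('n) * (l / t) powr \<gamma>"
      using powr_mono[OF \<gamma>(2) d] d by (intro mult_right_mono) auto
    also have "\<dots> \<le> (real CARD('n) + 2 * real CARD('m)) * (l / t) powr \<gamma>"
      by (intro mult_right_mono) auto
    finally have "A * P * ?J * (norm (x - x') / t) powr \<gamma>
        \<le> A * P * ?J * ((real CARD('n) + 2 * real CARD('m)) * (l / t) powr \<gamma>)"
      using c by (rule mult_left_mono)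
    then show "cmod (kernel_integral h t x - kernel_integral h t x') \<le> ?B * (l / t) powr \<gamma>"
      using kernel_integral_regular[OF h t, of x x'] by (simp only: mult.assoc)
  qed
  then show ?thesis by (simp add: smoothing_const_def mult_ac)
qed

end

section \<open>Lebesgue norms, cubes and Borel representatives\<close>

text \<open>Reciprocal exponents become the reals \<open>enn2real (inverse q)\<close>, with value 0
  at \<open>q = \<infinity>\<close>, so that finite and infinite exponents share one
  formula.\<close>

lemma inverse_ge_one_ennreal:
  assumes "1 \<le> (q::ennreal)"
  shows "inverse q < \<infinity>" "q \<noteq> \<infinity> \<Longrightarrow> 1 \<le> enn2real q \<and> q = ennreal (enn2real q)"
    "enn2real (inverse q) = (if q = \<infinity> then 0 else 1 / enn2real q)"
  using assms
proof -
  show "inverse q < \<infinity>" using assms by (auto simp: less_top[symmetric])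
  show 1: "q \<noteq> \<infinity> \<Longrightarrow> 1 \<le> enn2real q \<and> q = ennreal (enn2real q)"
    using assms by (cases q) auto
  show "enn2real (inverse q) = (if q = \<infinity> then 0 else 1 / enn2real q)"
    using 1 assms by (cases q) (auto simp: inverse_ennreal inverse_eq_divide)
qed

text \<open>The sup bound times the measure of the support to the power 1/q. For
  \<open>q = \<infinity>\<close> the last factor is \<open>V powr 0\<close>, which is 1 because
  \<open>V > 0\<close>; in HOL \<open>0 powr 0\<close> is 0.\<close>

lemma Lp_norm_complex_bounded_support:
  fixes f :: "'a::euclidean_space \<Rightarrow> complex"
  assumes "1 \<le> q" and [measurable]: "f \<in> borel_measurable borel"
    and M: "\<And>x. cmod (f x) \<le> M" "0 \<le> M"
    and B: "B \<in> sets borel" "emeasure lborel B = ennreal V" "0 < V" "\<And>x. x \<notin> B \<Longrightarrow> f x = 0"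
  shows "Lp_norm_complex q f \<le> ennreal (M * V powr enn2real (inverse q))"
proof (cases "q = \<infinity>")
  case True
  have "f \<in> borel_measurable lebesgue" by (rule measurable_completion) simp
  then have "esssup lebesgue (\<lambda>x. ennreal (cmod (f x))) \<le> ennreal M"
    using M by (intro esssup_I) (auto simp: ennreal_leI)
  then show ?thesis
    using True B by (simp add: Lp_norm_complex_def Lp_norm_def)
next
  case False
  define r where "r = enn2real q"
  have r: "1 \<le> r" "enn2real (inverse q) = 1 / r"
    using inverse_ge_one_ennreal[OF \<open>1 \<le> q\<close>] False by (auto simp: r_def)
  have "(\<integral>\<^sup>+x. enn_powr (ennreal (cmod (f x))) r \<partial>lebesgue) \<le> (\<integral>\<^sup>+x. ennreal (M powr r) * indicator B x \<partial>lborel)"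
    unfolding nn_integral_completion
  proof (intro nn_integral_mono)
    fix x show "enn_powr (ennreal (cmod (f x))) r \<le> ennreal (M powr r) * indicator B x"
      using M r B(4)[of x] by (cases "x \<in> B") (auto simp: enn_powr_ennreal enn_powr_zero intro!: ennreal_leI powr_mono2)
  qed
  also have "\<dots> = ennreal (M powr r * V)"
    using B by (simp add: nn_integral_cmult_indicator ennreal_mult')
  finally have "Lp_norm_complex q f \<le> enn_powr (ennreal (M powr r * V)) (1 / r)"
    using False r by (simp add: Lp_norm_complex_def Lp_norm_def r_def[symmetric] enn_powr_mono)
  also have "\<dots> = ennreal (M * V powr (1 / r))"
    using M B r by (simp add: enn_powr_ennreal powr_mult powr_powr)
  finally show ?thesis by (simp add: r)
qed

text \<open>Substitute for the Hoelder inequality, from \<open>u \<le> s + s\<^bsup>1-p\<^esup> u\<^bsup>p\<^esup>\<close> pointwise.\<close>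

lemma nn_integral_le_of_enn_powr:
  fixes u :: "'a \<Rightarrow> ennreal"
  assumes [measurable]: "u \<in> borel_measurable M" and B [measurable]: "B \<in> sets M"
    and V: "emeasure M B = ennreal V" "0 \<le> V" and p: "1 \<le> p" and s: "0 < s"
    and le: "(\<integral>\<^sup>+x. enn_powr (u x) p \<partial>M) \<le> ennreal (s powr p * V)"
  shows "(\<integral>\<^sup>+x\<in>B. u x \<partial>M) \<le> ennreal (2 * s * V)"
proof -
  have pw: "v \<le> ennreal s + ennreal (s powr (1 - p)) * enn_powr v p" for v
  proof (cases v)
    case (real r)
    have "r \<le> s + s powr (1 - p) * r powr p"
    proof (cases "r \<le> s")
      case False
      have "r = s powr (1 - p) * r powr p * (s / r) powr (p - 1)"
        using False s by (simp add: powr_divide powr_diff)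
      also have "\<dots> \<le> s powr (1 - p) * r powr p * 1"
        using False s p by (intro mult_left_mono powr_le1) auto
      finally show ?thesis using s by simp
    qed (simp add: add_increasing2)
    then show ?thesis
      using real s by (simp add: enn_powr_ennreal ennreal_mult'[symmetric] ennreal_plus[symmetric]
          ennreal_leI del: ennreal_plus)
  qed (use s in \<open>simp add: ennreal_mult_top\<close>)
  have "(\<integral>\<^sup>+x\<in>B. u x \<partial>M) \<le> (\<integral>\<^sup>+x. ennreal s * indicator B x + ennreal (s powr (1 - p)) * enn_powr (u x) p \<partial>M)"
    using pw by (intro nn_integral_mono) (auto simp: indicator_def)
  also have "\<dots> = ennreal s * ennreal V + ennreal (s powr (1 - p)) * (\<integral>\<^sup>+x. enn_powr (u x) p \<partial>M)"
    by (simp add: nn_integral_add nn_integral_cmult V)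
  also have "\<dots> \<le> ennreal s * ennreal V + ennreal (s powr (1 - p)) * ennreal (s powr p * V)"
    by (intro add_mono mult_left_mono le) auto
  also have "\<dots> = ennreal (s * V + s powr (1 - p) * (s powr p * V))"
    using s V by (simp add: ennreal_mult'[symmetric])
  also have "s powr (1 - p) * (s powr p * V) = s * V"
    using s by (simp add: mult.assoc[symmetric] powr_add[symmetric])
  finally show ?thesis by (simp add: mult_ac)
qed

text \<open>\<open>enn2real\<close> sends \<open>\<infinity>\<close> to 0, so finiteness has to be
  settled first: if \<open>w\<close> is infinite there is nothing to prove, and otherwise
  \<open>u\<close> is finite because \<open>v\<close> is.\<close>

lemma ennreal_abs_diff_le:
  assumes "u \<le> v + ennreal k + w" "v \<le> u + w + ennreal k" "v < \<infinity>" "0 \<le> k"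
  shows "ennreal \<bar>enn2real u - enn2real v\<bar> \<le> ennreal k + w"
proof (cases w)
  case (real c)
  with assms have "u < \<infinity>"
    by (auto simp: less_top[symmetric] top_unique)
  with assms real show ?thesis
    by (cases u; cases v)
      (auto simp: ennreal_plus[symmetric] ennreal_le_iff abs_le_iff simp del: ennreal_plus)
qed simp

section \<open>Products of component functions, and cubes\<close>

lemma measurable_prod_component:
  assumes [measurable]: "\<And>i. f i \<in> borel_measurable borel"
  shows "(\<lambda>y::'a::euclidean_space^'m. \<Prod>i\<in>UNIV. f i (y $ i) :: complex) \<in> borel_measurable borel"
  by measurable

lemma cmod_prod_component_le:
  "(\<And>i x. cmod (f i x) \<le> M i) \<Longrightarrow> cmod (\<Prod>i\<in>UNIV. f i (y $ i)) \<le> (\<Prod>i\<in>UNIV. M i)"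
  by (simp add: prod_norm[symmetric] prod_mono)

text \<open>The second box is the concentric cube with three times the side; a point outside it is
  separated from the inner cube by at least \<open>l\<close> in some coordinate. The bound by
  \<open>CARD('n) * l\<close> is the crude one through the l^1 norm.\<close>

lemma cube_props:
  fixes a :: "real^'n::finite"
  assumes "0 < l"
  shows "emeasure lborel (cbox a (a + vec l)) = ennreal (l ^ CARD('n))"
    and "emeasure lborel (cbox (a - vec l) (a + vec (2 * l))) = ennreal (3 ^ CARD('n) * l ^ CARD('n))"
    and "cbox a (a + vec l) \<subseteq> cbox (a - vec l) (a + vec (2 * l))"
    and "x \<in> cbox a (a + vec l) \<Longrightarrow> z \<notin> cbox (a - vec l) (a + vec (2 * l)) \<Longrightarrow> l \<le> norm (x - z)"
    and "x \<in> cbox a (a + vec l) \<Longrightarrow> norm (x - a) \<le> real CARD('n) * l"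
proof -
  have ne: "cbox a (a + vec l) \<noteq> {}" "cbox (a - vec l) (a + vec (2 * l)) \<noteq> {}"
    using assms by (auto simp: interval_ne_empty_cart)
  have emeasure: "emeasure lborel (cbox c d) = ennreal (measure lborel (cbox c d))" for c d :: "real^'n"
    by (rule emeasure_eq_ennreal_measure)
      (use emeasure_lborel_cbox_finite[of c d] in \<open>auto simp: less_top simp del: emeasure_lborel_cbox\<close>)
  show "emeasure lborel (cbox a (a + vec l)) = ennreal (l ^ CARD('n))"
    by (simp only: emeasure content_cbox_cart[OF ne(1)]) simp
  show "emeasure lborel (cbox (a - vec l) (a + vec (2 * l))) = ennreal (3 ^ CARD('n) * l ^ CARD('n))"
  proof -
    have "(a + vec (2 * l)) $ i - (a - vec l) $ i = 3 * l" for i by simp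
    then show ?thesis
      by (simp only: emeasure content_cbox_cart[OF ne(2)] prod_constant power_mult_distrib)
  qed
  show "cbox a (a + vec l) \<subseteq> cbox (a - vec l) (a + vec (2 * l))"
  proof
    fix x assume "x \<in> cbox a (a + vec l)"
    then have x: "a $ i \<le> x $ i" "x $ i \<le> a $ i + l" for i
      by (auto simp: mem_box_cart)
    have "a $ i - l \<le> x $ i" "x $ i \<le> a $ i + 2 * l" for i
      using x[of i] assms by linarith+
    then show "x \<in> cbox (a - vec l) (a + vec (2 * l))"
      by (simp add: mem_box_cart)
  qed
  show "l \<le> norm (x - z)" if x: "x \<in> cbox a (a + vec l)" and z: "z \<notin> cbox (a - vec l) (a + vec (2 * l))"
  proof -
    obtain k where "z $ k < a $ k - l \<or> a $ k + 2 * l < z $ k"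
      using z by (auto simp: mem_box_cart not_le)
    moreover have "a $ k \<le> x $ k" "x $ k \<le> a $ k + l"
      using x by (auto simp: mem_box_cart)
    ultimately have "l \<le> \<bar>(x - z) $ k\<bar>" using assms by auto
    also have "\<dots> \<le> norm (x - z)" by (rule component_le_norm_cart)
    finally show ?thesis .
  qed
  show "norm (x - a) \<le> real CARD('n) * l" if "x \<in> cbox a (a + vec l)"
  proof -
    have "norm (x - a) \<le> (\<Sum>i\<in>UNIV. \<bar>(x - a) $ i\<bar>)" by (rule norm_le_l1_cart)
    also have "\<dots> \<le> (\<Sum>i\<in>(UNIV::'n set). l)"
      using that by (intro sum_mono) (auto simp: mem_box_cart abs_le_iff algebra_simps)
    finally show ?thesis by simp
  qed
qed

section \<open>Borel representatives and changes on null sets\<close>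

lemma lebesgue_complex_ex_borel:
  fixes f :: "'a::euclidean_space \<Rightarrow> complex"
  assumes "f \<in> borel_measurable lebesgue"
  obtains g where "g \<in> borel_measurable borel" "AE x in lborel. f x = g x"
proof -
  have "(\<lambda>x. Re (f x)) \<in> borel_measurable lebesgue" "(\<lambda>x. Im (f x)) \<in> borel_measurable lebesgue"
    using assms by measurable
  from this[THEN completion_ex_borel_measurable_real]
  obtain u v where uv: "u \<in> borel_measurable lborel" "AE x in lborel. Re (f x) = u x"
      "v \<in> borel_measurable lborel" "AE x in lborel. Im (f x) = v x"
    by blast
  show thesis
  proof
    show "(\<lambda>x. Complex (u x) (v x)) \<in> borel_measurable borel"
      using uv unfolding borel_measurable_complex_iff by simp
    show "AE x in lborel. f x = Complex (u x) (v x)"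
      using uv(2,4) by eventually_elim (simp add: complex_eq_iff)
  qed
qed

text \<open>Set a Borel representative to 0 wherever the norm bound fails or the point leaves a ball
  around the support. Both properties then hold at every point, not merely almost
  everywhere.\<close>

lemma in_Linf_compact_support_ex_borel:
  fixes f :: "'a::euclidean_space \<Rightarrow> complex"
  assumes "in_Linf_compact_support f"
  obtains g R where "g \<in> borel_measurable borel" "AE x in lborel. f x = g x"
    "\<And>x. cmod (g x) \<le> enn2real (Lp_norm_complex \<infinity> f)" "\<And>x. x \<notin> cball 0 R \<Longrightarrow> g x = 0"
proof -
  let ?M = "enn2real (Lp_norm_complex \<infinity> f)"
  obtain K where f: "f \<in> borel_measurable lebesgue" and fin: "Lp_norm_complex \<infinity> f < \<infinity>"
      and K: "compact K" "AE x in lebesgue. x \<notin> K \<longrightarrow> f x = 0"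
    using assms by (auto simp: in_Linf_compact_support_def in_Lp_def)
  obtain R where R: "K \<subseteq> cball 0 R"
    using compact_imp_bounded[OF K(1)] by (auto simp: bounded_iff subset_iff)
  obtain g where [measurable]: "g \<in> borel_measurable borel" and g: "AE x in lborel. f x = g x"
    using lebesgue_complex_ex_borel[OF f] .
  have "AE x in lborel. ennreal (cmod (f x)) \<le> Lp_norm_complex \<infinity> f"
    using esssup_AE[of "\<lambda>x. ennreal (cmod (f x))" lebesgue]
    by (simp add: AE_completion_iff Lp_norm_complex_def Lp_norm_def)
  then have M: "AE x in lborel. cmod (f x) \<le> ?M"
  proof eventually_elim
    case (elim x)
    then have "ennreal (cmod (f x)) \<le> ennreal ?M" using fin by simp
    then show ?case by (simp add: ennreal_le_iff)
  qed
  let ?g = "\<lambda>x. if cmod (g x) \<le> ?M \<and> x \<in> cball 0 R then g x else 0"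
  show thesis
  proof
    have [measurable]: "cball (0::'a) R \<in> sets borel" by simp
    show "?g \<in> borel_measurable borel" by measurable
    show "AE x in lborel. f x = ?g x"
      using g M K(2)[unfolded AE_completion_iff] by eventually_elim (use R in auto)
  qed auto
qed

text \<open>Completeness of Lebesgue measure: the preimages under \<open>f\<close> and
  \<open>g\<close> differ by a null set.\<close>

lemma borel_measurable_lebesgue_cong_AE:
  fixes f g :: "'a::euclidean_space \<Rightarrow> 'b::topological_space"
  assumes g: "g \<in> borel_measurable lebesgue" and ae: "AE x in lebesgue. g x = f x"
  shows "f \<in> borel_measurable lebesgue"
proof (rule measurableI)
  fix S :: "'b set" assume "S \<in> sets borel"
  then have S: "g -` S \<inter> space lebesgue \<in> sets lebesgue"
    by (rule measurable_sets[OF g])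
  have "AE x in lebesgue. x \<in> g -` S \<inter> space lebesgue \<longleftrightarrow> x \<in> f -` S \<inter> space lebesgue"
    using ae by eventually_elim simp
  then show "f -` S \<inter> space lebesgue \<in> sets lebesgue"
    by (rule completion.in_sets_AE[OF _ S]) simp
qed simp

lemma multilinear_op_cong_AE:
  fixes f g :: "'m::finite \<Rightarrow> real^'n \<Rightarrow> complex"
  assumes "\<And>i. AE x in lborel. f i x = g i x" and "\<theta> t x \<in> borel_measurable borel"
    and [measurable]: "\<And>i. g i \<in> borel_measurable borel"
  shows "multilinear_op \<theta> t f x = (LINT y|lborel. \<theta> t x y * (\<Prod>i\<in>UNIV. g i (y $ i)))"
proof -
  note assms(2)[measurable]
  have m: "(\<lambda>y. \<theta> t x y * (\<Prod>i\<in>UNIV. g i (y $ i))) \<in> borel_measurable borel" by measurable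
  have "\<forall>i\<in>UNIV. AE y::real^'n^'m in lborel. f i (y $ i) = g i (y $ i)"
    using AE_lborel_vec_nth[OF assms(1)] by blast
  from eventually_ball_finite[OF finite this]
  have ae: "AE y in lborel. \<theta> t x y * (\<Prod>i\<in>UNIV. g i (y $ i)) = \<theta> t x y * (\<Prod>i\<in>UNIV. f i (y $ i))"
    by eventually_elim simp
  have "multilinear_op \<theta> t f x = (LINT y|lebesgue. \<theta> t x y * (\<Prod>i\<in>UNIV. g i (y $ i)))"
    unfolding multilinear_op_def
  proof (rule integral_cong_AE)
    show g: "(\<lambda>y. \<theta> t x y * (\<Prod>i\<in>UNIV. g i (y $ i))) \<in> borel_measurable lebesgue"
      using m by (intro measurable_completion) simp
    from this show "(\<lambda>y. \<theta> t x y * (\<Prod>i\<in>UNIV. f i (y $ i))) \<in> borel_measurable lebesgue"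
      using AE_completion[OF ae] by (rule borel_measurable_lebesgue_cong_AE)
    show "AE y in lebesgue. \<theta> t x y * (\<Prod>i\<in>UNIV. f i (y $ i)) = \<theta> t x y * (\<Prod>i\<in>UNIV. g i (y $ i))"
      using AE_completion[OF ae] by eventually_elim (rule sym)
  qed
  also have "\<dots> = (LINT y|lborel. \<theta> t x y * (\<Prod>i\<in>UNIV. g i (y $ i)))"
    using m by (intro integral_completion) simp
  finally show ?thesis .
qed

section \<open>Mean oscillation of the square function\<close>

locale bounded_square_function = square_function_kernel \<theta> N \<gamma> A
  for \<theta> :: "real \<Rightarrow> real^'n \<Rightarrow> real^'n^'m \<Rightarrow> complex" and N \<gamma> A :: real +
  fixes q :: "'m \<Rightarrow> ennreal" and p :: ennreal and C' :: real
  assumes exponents: "1 \<le> p" "\<And>i. 1 \<le> q i" "inverse p = (\<Sum>i\<in>UNIV. inverse (q i))"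
    and C': "0 < C'"
    and bounded: "\<And>f. (\<And>i. in_Lp (q i) (f i)) \<Longrightarrow>
        Lp_norm p (square_function \<theta> f) \<le> ennreal C' * (\<Prod>i\<in>UNIV. Lp_norm_complex (q i) (f i))"
begin

section \<open>Local integral bounds for the square function\<close>

lemma square_function_eq:
  fixes f g :: "'m \<Rightarrow> real^'n \<Rightarrow> complex"
  assumes "\<And>i. AE x in lborel. f i x = g i x" and "\<And>i. g i \<in> borel_measurable borel"
  shows "square_function \<theta> f
      = (\<lambda>x. dilation_L2_norm (\<lambda>t. kernel_integral (\<lambda>y. \<Prod>i\<in>UNIV. g i (y $ i)) t x))"
proof
  fix x
  have "square_function \<theta> f x = dilation_L2_norm (\<lambda>t. multilinear_op \<theta> t f x)"
    by (simp add: square_function_def dilation_L2_norm_def)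
  also have "\<dots> = dilation_L2_norm (\<lambda>t. kernel_integral (\<lambda>y. \<Prod>i\<in>UNIV. g i (y $ i)) t x)"
    using multilinear_op_cong_AE[OF assms(1) borel_measurable_kernel assms(2)]
    by (intro dilation_L2_norm_cong) (simp add: kernel_integral_def)
  finally show "square_function \<theta> f x
      = dilation_L2_norm (\<lambda>t. kernel_integral (\<lambda>y. \<Prod>i\<in>UNIV. g i (y $ i)) t x)" .
qed

lemma sum_inverse_exponents: "(\<Sum>i\<in>UNIV. enn2real (inverse (q i))) = enn2real (inverse p)"
  unfolding exponents(3) using inverse_ge_one_ennreal(1)[OF exponents(2)]
  by (subst enn2real_sum) auto

context
  fixes f :: "'m \<Rightarrow> real^'n \<Rightarrow> complex" and M :: "'m \<Rightarrow> real"
  assumes f [measurable]: "\<And>i. f i \<in> borel_measurable borel"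
    and M: "\<And>i x. cmod (f i x) \<le> M i" "\<And>i. 0 < M i"
begin

lemma borel_measurable_square_function: "square_function \<theta> f \<in> borel_measurable borel"
  unfolding square_function_eq[of f f, OF AE_I2[OF refl] f]
  by (rule borel_measurable_square[OF measurable_prod_component cmod_prod_component_le])
    (use f M(1) in auto)

text \<open>The mean over a set carrying all supports is bounded independently of that set. Applied
  to the enlarged cube it gives the local estimate, and to large balls it gives finiteness.\<close>

lemma nn_integral_square_function_le:
  assumes B: "B \<in> sets borel" "emeasure lborel B = ennreal V" "0 < V" "\<And>i x. x \<notin> B \<Longrightarrow> f i x = 0"
  shows "(\<integral>\<^sup>+x\<in>B. square_function \<theta> f x \<partial>lborel) \<le> ennreal (2 * (C' * (\<Prod>i\<in>UNIV. M i)) * V)"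
proof -
  let ?P = "\<Prod>i\<in>UNIV. M i" and ?S = "square_function \<theta> f"
  have P: "0 < ?P" using M(2) by (simp add: prod_pos)
  note S [measurable] = borel_measurable_square_function
  have Lq: "Lp_norm_complex (q i) (f i) \<le> ennreal (M i * V powr enn2real (inverse (q i)))" for i
    using M B by (intro Lp_norm_complex_bounded_support[OF exponents(2) f]) (auto simp: less_imp_le)
  have "in_Lp (q i) (f i)" for i
    unfolding in_Lp_def using order_le_less_trans[OF Lq ennreal_less_top]
    by (auto intro!: measurable_completion)
  then have "Lp_norm p ?S \<le> ennreal C' * (\<Prod>i\<in>UNIV. Lp_norm_complex (q i) (f i))"
    by (rule bounded)
  also have "\<dots> \<le> ennreal C' * (\<Prod>i\<in>UNIV. ennreal (M i * V powr enn2real (inverse (q i))))"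
    by (intro mult_left_mono prod_mono_ennreal Lq) simp
  also have "\<dots> = ennreal (C' * (\<Prod>i\<in>UNIV. M i * V powr enn2real (inverse (q i))))"
    using C' M(2) by (subst prod_ennreal) (auto simp: ennreal_mult' less_imp_le)
  \<comment> \<open>Here the relation between the exponents enters: the powers of \<open>V\<close>
    combine to the exponent 1/p, which the p-th power later turns into \<open>V\<close>
    itself.\<close>
  also have "(\<Prod>i\<in>UNIV. M i * V powr enn2real (inverse (q i))) = ?P * V powr enn2real (inverse p)"
    using \<open>0 < V\<close> by (simp add: prod.distrib powr_sum[symmetric] sum_inverse_exponents)
  finally have norm: "Lp_norm p ?S \<le> ennreal (C' * ?P * V powr enn2real (inverse p))"
    by (simp add: mult.assoc)
  show ?thesis
  proof (cases "p = \<infinity>")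
    case True
    have "AE x in lborel. ?S x \<le> ennreal (C' * ?P)"
      using esssup_AE[of ?S lebesgue] norm True \<open>0 < V\<close>
      by (auto simp: AE_completion_iff Lp_norm_def elim!: eventually_mono)
    then have "(\<integral>\<^sup>+x\<in>B. ?S x \<partial>lborel) \<le> (\<integral>\<^sup>+x. ennreal (C' * ?P) * indicator B x \<partial>lborel)"
      by (intro nn_integral_mono_AE) (auto simp: indicator_def)
    also have "\<dots> = ennreal (C' * ?P * V)"
      using B C' P by (simp add: nn_integral_cmult_indicator ennreal_mult')
    also have "\<dots> \<le> ennreal (2 * (C' * ?P) * V)"
      using C' P \<open>0 < V\<close> by (intro ennreal_leI) simp
    finally show ?thesis .
  next
    case False
    define r where "r = enn2real p"
    have r: "1 \<le> r" "enn2real (inverse p) = 1 / r"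
      using inverse_ge_one_ennreal[OF exponents(1)] False by (auto simp: r_def)
    have "enn_powr (\<integral>\<^sup>+x. enn_powr (?S x) r \<partial>lborel) (1 / r) \<le> ennreal (C' * ?P * V powr (1 / r))"
      using norm False r by (simp add: Lp_norm_def r_def nn_integral_completion)
    from enn_powr_mono[OF this, of r]
    have "(\<integral>\<^sup>+x. enn_powr (?S x) r \<partial>lborel) \<le> ennreal ((C' * ?P) powr r * V)"
      using r C' P \<open>0 < V\<close>
      by (simp add: enn_powr_powr enn_powr_one enn_powr_ennreal powr_mult powr_powr)
    \<comment> \<open>The substitute for Hoelder is used with \<open>s = C' * ?P\<close>; its two
      terms both equal \<open>s * V\<close>, hence the factor 2.\<close>
    then show ?thesis
      using B r C' P by (intro nn_integral_le_of_enn_powr[of _ _ _ _ r]) auto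
  qed
qed

text \<open>Apply the local bound on a ball containing both the supports and the region of
  integration. That bound grows with the ball, so only its finiteness is recorded.\<close>

lemma nn_integral_square_function_ball:
  assumes "\<And>i x. x \<notin> cball 0 R \<Longrightarrow> f i x = 0"
  shows "(\<integral>\<^sup>+x\<in>cball 0 r. square_function \<theta> f x \<partial>lborel) < \<infinity>"
proof -
  \<comment> \<open>The \<open>max 1\<close> makes the radius, and hence the measure,
    positive.\<close>
  let ?B = "cball (0::real^'n) (max 1 (max R r))"
  have "emeasure lborel ?B = ennreal (measure lborel ?B)"
    using emeasure_lborel_cball_finite[of "0::real^'n" "max 1 (max R r)"]
    by (intro emeasure_eq_ennreal_measure) auto
  moreover have "0 < measure lborel ?B"
    by (rule content_cball_pos) simp
  ultimately have "(\<integral>\<^sup>+x\<in>?B. square_function \<theta> f x \<partial>lborel) < \<infinity>"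
    using nn_integral_square_function_le[of ?B "measure lborel ?B"] assms
    by (auto intro: order_le_less_trans)
  moreover have "(\<integral>\<^sup>+x\<in>cball 0 r. square_function \<theta> f x \<partial>lborel) \<le> (\<integral>\<^sup>+x\<in>?B. square_function \<theta> f x \<partial>lborel)"
    by (intro nn_integral_mono) (auto simp: indicator_def)
  ultimately show ?thesis by (rule order_le_less_trans[rotated])
qed

lemma square_function_finite_AE:
  assumes "\<And>i x. x \<notin> cball 0 R \<Longrightarrow> f i x = 0"
  shows "AE x in lborel. square_function \<theta> f x < \<infinity>"
proof -
  note borel_measurable_square_function [measurable]
  have [measurable]: "cball (0::real^'n) r \<in> sets borel" for r by simp
  have fin: "(\<integral>\<^sup>+x\<in>cball 0 (real k). square_function \<theta> f x \<partial>lborel) < \<infinity>" for k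
    using assms by (rule nn_integral_square_function_ball)
  have "AE x in lborel. square_function \<theta> f x * indicator (cball 0 (real k)) x \<noteq> \<infinity>" for k :: nat
    using fin[of k] by (intro nn_integral_noteq_infinite) auto
  then have "AE x in lborel. \<forall>k::nat. square_function \<theta> f x * indicator (cball 0 (real k)) x \<noteq> \<infinity>"
    by (simp add: AE_all_countable)
  then show ?thesis
  proof eventually_elim
    case (elim x)
    obtain k :: nat where "norm x \<le> real k" using real_arch_simple by blast
    with elim[rule_format, of k] show ?case by (simp add: less_top)
  qed
qed

lemma set_integrable_square_function:
  assumes "\<And>i x. x \<notin> cball 0 R \<Longrightarrow> f i x = 0" and K: "K \<in> sets borel" "K \<subseteq> cball 0 r"
  shows "set_integrable lebesgue K (\<lambda>x. enn2real (square_function \<theta> f x))"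
  unfolding set_integrable_def
proof (rule integrableI_bounded)
  note borel_measurable_square_function [measurable] K(1) [measurable]
  have "(\<lambda>x. indicator K x *\<^sub>R enn2real (square_function \<theta> f x)) \<in> borel_measurable borel"
    by measurable
  then show "(\<lambda>x. indicator K x *\<^sub>R enn2real (square_function \<theta> f x)) \<in> borel_measurable lebesgue"
    by (intro measurable_completion) simp
  have "(\<integral>\<^sup>+x. ennreal (norm (indicator K x *\<^sub>R enn2real (square_function \<theta> f x))) \<partial>lebesgue)
      \<le> (\<integral>\<^sup>+x\<in>cball 0 r. square_function \<theta> f x \<partial>lborel)"
    unfolding nn_integral_completion
  proof (intro nn_integral_mono)
    fix x
    have "ennreal (enn2real (square_function \<theta> f x)) \<le> square_function \<theta> f x"
      by (cases "square_function \<theta> f x") auto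
    then show "ennreal (norm (indicator K x *\<^sub>R enn2real (square_function \<theta> f x)))
        \<le> square_function \<theta> f x * indicator (cball 0 r) x"
      using K(2) by (auto simp: indicator_def)
  qed
  also have "\<dots> < \<infinity>"
    using assms(1) by (rule nn_integral_square_function_ball)
  finally show "(\<integral>\<^sup>+x. ennreal (norm (indicator K x *\<^sub>R enn2real (square_function \<theta> f x))) \<partial>lebesgue) < \<infinity>" .
qed

end

text \<open>The first term is the oscillation of the remainder. The second is the mean of the local
  part: the enlarged cube, which carries its support, has \<open>3 ^ CARD('n)\<close> times the
  measure of the cube.\<close>

definition bmo_const :: real where
  "bmo_const = smoothing_const + 2 * C' * 3 ^ CARD('n)"

text \<open>The constant \<open>c\<close> is the square function of the far remainder
  \<open>hd\<close>, evaluated at the corner \<open>a\<close> of the cube.\<close>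

lemma cube_oscillation:
  fixes f :: "'m \<Rightarrow> real^'n \<Rightarrow> complex" and a :: "real^'n"
  assumes f [measurable]: "\<And>i. f i \<in> borel_measurable borel"
    and M: "\<And>i x. cmod (f i x) \<le> M i" "\<And>i. 0 < M i"
    and R: "\<And>i x. x \<notin> cball 0 R \<Longrightarrow> f i x = 0"
    and l: "0 < l"
  defines "Q \<equiv> cbox a (a + vec l)"
  shows "\<exists>c. (\<integral>\<^sup>+x\<in>Q. ennreal \<bar>enn2real (square_function \<theta> f x) - c\<bar> \<partial>lborel)
      \<le> ennreal (bmo_const * (\<Prod>i\<in>UNIV. M i) * l ^ CARD('n))"
proof -
  let ?P = "\<Prod>i\<in>UNIV. M i"
  have P: "0 < ?P" using M(2) by (simp add: prod_pos)
  define Q' where "Q' = cbox (a - vec l) (a + vec (2 * l))"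
  have Q': "Q \<subseteq> Q'" "emeasure lborel Q = ennreal (l ^ CARD('n))"
      "emeasure lborel Q' = ennreal (3 ^ CARD('n) * l ^ CARD('n))"
      "\<And>x z. x \<in> Q \<Longrightarrow> z \<notin> Q' \<Longrightarrow> l \<le> norm (x - z)" "\<And>x. x \<in> Q \<Longrightarrow> norm (x - a) \<le> real CARD('n) * l"
    unfolding Q_def Q'_def using cube_props[OF l] by auto
  have [measurable]: "Q \<in> sets borel" "Q' \<in> sets borel" by (auto simp: Q_def Q'_def)
  have a: "a \<in> Q" using l by (simp add: Q_def mem_box_cart)
  define f0 where "f0 i x = f i x * indicator Q' x" for i x
  have f0 [measurable]: "\<And>i. f0 i \<in> borel_measurable borel"
    unfolding f0_def[abs_def] by measurable
  have f0_le: "\<And>i x. cmod (f0 i x) \<le> M i"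
    using M by (auto simp: f0_def indicator_def less_imp_le)
  define h where "h y = (\<Prod>i\<in>UNIV. f i (y $ i))" for y :: "real^'n^'m"
  define h0 where "h0 y = (\<Prod>i\<in>UNIV. f0 i (y $ i))" for y :: "real^'n^'m"
  define hd where "hd y = h y - h0 y" for y
  have [measurable]: "h \<in> borel_measurable borel" "h0 \<in> borel_measurable borel" "hd \<in> borel_measurable borel"
    unfolding h_def[abs_def] h0_def[abs_def] hd_def[abs_def] by measurable
  have h_le: "cmod (h y) \<le> ?P" "cmod (h0 y) \<le> ?P" for y
    unfolding h_def h0_def using M f0_le by (auto intro!: cmod_prod_component_le)
  \<comment> \<open>Thus \<open>hd\<close> is at every point either 0 or \<open>h\<close>: it obeys
    the same bound \<open>?P\<close> and vanishes unless some component lies outside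
    \<open>Q'\<close>.\<close>
  have dichotomy: "h0 y = h y \<or> (h0 y = 0 \<and> (\<exists>j. y $ j \<notin> Q'))" for y
  proof (cases "\<exists>j. y $ j \<notin> Q'")
    case True
    then obtain j where "y $ j \<notin> Q'" ..
    then have "f0 j (y $ j) = 0" by (simp add: f0_def)
    then have "h0 y = 0" unfolding h0_def by (intro prod_zero) auto
    with True show ?thesis by blast
  qed (simp add: h_def h0_def f0_def)
  have hd_le: "cmod (hd y) \<le> ?P" for y
    using dichotomy[of y] h_le[of y] P by (auto simp: hd_def)
  have hd_far: "\<exists>j. l \<le> norm (x - y $ j)" if "hd y \<noteq> 0" "x \<in> Q" for x y
    using dichotomy[of y] that Q'(4) by (auto simp: hd_def)
  let ?S = "square_function \<theta> f" and ?T = "square_function \<theta> f0"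
  define H where "H x = dilation_L2_norm (\<lambda>t. kernel_integral hd t x)" for x
  have S: "?S x = dilation_L2_norm (\<lambda>t. kernel_integral h t x)" for x
    using square_function_eq[of f f, OF AE_I2[OF refl] f] by (simp add: h_def[abs_def])
  have S0: "?T x = dilation_L2_norm (\<lambda>t. kernel_integral h0 t x)" for x
    using square_function_eq[of f0 f0, OF AE_I2[OF refl] f0] by (simp add: h0_def[abs_def])
  have diff: "kernel_integral hd t x = kernel_integral h t x - kernel_integral h0 t x" if "0 < t" for t x
    unfolding hd_def[abs_def] using that h_le by (intro kernel_integral_diff) auto
  note meas = measurable_kernel_integral[of h] measurable_kernel_integral[of h0] measurable_kernel_integral[of hd]
  \<comment> \<open>This and \<open>H_le\<close> together are the two-sided comparison, kept as sums
    because the three quantities may be infinite.\<close>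
  have S_le: "?S x \<le> H x + ?T x" for x
    unfolding S S0 H_def
  proof (rule dilation_L2_norm_triangle)
    fix t :: real assume "0 < t"
    then show "cmod (kernel_integral h t x) \<le> cmod (kernel_integral hd t x) + cmod (kernel_integral h0 t x)"
      using norm_triangle_ineq[of "kernel_integral hd t x" "kernel_integral h0 t x"] by (simp add: diff)
  qed (use meas in simp_all)
  have H_le: "H x \<le> ?S x + ?T x" for x
    unfolding S S0 H_def
    by (rule dilation_L2_norm_triangle) (use meas in \<open>simp_all add: diff norm_triangle_ineq4\<close>)
  define k where "k = smoothing_const * ?P"
  have k: "0 \<le> k" using P smoothing_const_nonneg by (simp add: k_def)
  have osc: "H x \<le> H x' + ennreal k" if "x \<in> Q" "x' \<in> Q" "norm (x - x') \<le> real CARD('n) * l" for x x'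
  proof -
    have "H x \<le> H x' + dilation_L2_norm (\<lambda>t. kernel_integral hd t x - kernel_integral hd t x')"
      unfolding H_def
    proof (rule dilation_L2_norm_triangle)
      show "cmod (kernel_integral hd t x) \<le> cmod (kernel_integral hd t x')
          + cmod (kernel_integral hd t x - kernel_integral hd t x')" for t
        using norm_triangle_ineq[of "kernel_integral hd t x'" "kernel_integral hd t x - kernel_integral hd t x'"]
        by simp
    qed (use meas in \<open>auto intro!: borel_measurable_diff\<close>)
    also have "\<dots> \<le> H x' + ennreal k"
      unfolding k_def using that hd_far hd_le l by (intro add_left_mono far_part_oscillation) auto
    finally show ?thesis .
  qed
  have fin: "AE x in lborel. ?S x < \<infinity>" "AE x in lborel. ?T x < \<infinity>"
    using square_function_finite_AE[where f = f and R = R, OF f M R]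
      square_function_finite_AE[where f = f0 and R = R, OF f0 f0_le M(2)] R
    by (simp_all add: f0_def)
  \<comment> \<open>Finiteness of \<open>H a\<close> cannot be read off at \<open>a\<close>, which
    may be an exceptional point. A good point exists because \<open>Q\<close> has positive measure,
    and \<open>osc\<close> carries finiteness from there to \<open>a\<close>.\<close>
  have "\<exists>x\<in>Q. ?S x < \<infinity> \<and> ?T x < \<infinity>"
  proof (rule ccontr)
    assume none: "\<not> (\<exists>x\<in>Q. ?S x < \<infinity> \<and> ?T x < \<infinity>)"
    have "AE x in lborel. x \<notin> Q"
      using fin by eventually_elim (use none in auto)
    then have "emeasure lborel Q = 0"
      by (subst (asm) AE_iff_measurable[of Q]) auto
    then show False using Q'(2) l by simp
  qed
  then obtain x where x: "x \<in> Q" "?S x < \<infinity>" "?T x < \<infinity>" by blast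
  have "H a \<le> H x + ennreal k"
    using Q'(5)[OF x(1)] x(1) a by (intro osc) (simp_all add: norm_minus_commute)
  also have "\<dots> \<le> (?S x + ?T x) + ennreal k"
    by (intro add_right_mono H_le)
  also have "\<dots> < \<infinity>" using x by simp
  finally have Ha: "H a < \<infinity>" .
  have pw: "ennreal \<bar>enn2real (?S x) - enn2real (H a)\<bar> \<le> ennreal k + ?T x" if "x \<in> Q" for x
  proof (rule ennreal_abs_diff_le[OF _ _ Ha k])
    have "?S x \<le> (H a + ennreal k) + ?T x"
      using S_le[of x] osc[OF that a Q'(5)[OF that]] by (meson add_right_mono order_trans)
    then show "?S x \<le> H a + ennreal k + ?T x" .
    have "H a \<le> H x + ennreal k"
      using Q'(5)[OF that] that a by (intro osc) (simp_all add: norm_minus_commute)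
    then show "H a \<le> ?S x + ?T x + ennreal k"
      using H_le[of x] by (meson add_right_mono order_trans)
  qed
  have [measurable]: "?T \<in> borel_measurable borel"
    by (rule borel_measurable_square_function[OF f0 f0_le M(2)])
  \<comment> \<open>The local term is integrated over \<open>Q'\<close> instead of \<open>Q\<close>,
    since the local bound asks for a set that carries the supports of the
    \<open>f0 i\<close>.\<close>
  have "(\<integral>\<^sup>+x\<in>Q. ennreal \<bar>enn2real (?S x) - enn2real (H a)\<bar> \<partial>lborel)
      \<le> (\<integral>\<^sup>+x. ennreal k * indicator Q x + ?T x * indicator Q' x \<partial>lborel)"
    using pw Q'(1) by (intro nn_integral_mono) (auto simp: indicator_def)
  also have "\<dots> = ennreal k * ennreal (l ^ CARD('n)) + (\<integral>\<^sup>+x\<in>Q'. ?T x \<partial>lborel)"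
    by (simp add: nn_integral_add nn_integral_cmult_indicator Q'(2))
  also have "\<dots> \<le> ennreal k * ennreal (l ^ CARD('n)) + ennreal (2 * (C' * ?P) * (3 ^ CARD('n) * l ^ CARD('n)))"
    using l by (intro add_left_mono nn_integral_square_function_le[OF f0 f0_le M(2)] Q'(3)) (auto simp: f0_def)
  also have "\<dots> = ennreal (k * l ^ CARD('n) + 2 * (C' * ?P) * (3 ^ CARD('n) * l ^ CARD('n)))"
    using k l C' P by (simp add: ennreal_mult'[symmetric])
  also have "k * l ^ CARD('n) + 2 * (C' * ?P) * (3 ^ CARD('n) * l ^ CARD('n)) = bmo_const * ?P * l ^ CARD('n)"
    by (simp add: bmo_const_def k_def algebra_simps)
  finally show ?thesis by blast
qed

section \<open>From a single cube to the BMO norm\<close>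

lemma bmo_const_nonneg: "0 \<le> bmo_const"
  unfolding bmo_const_def using smoothing_const_nonneg C' by simp

lemma BMO_norm_square_function_le:
  fixes f :: "'m \<Rightarrow> real^'n \<Rightarrow> complex"
  assumes f: "\<And>i. f i \<in> borel_measurable borel"
    and M: "\<And>i x. cmod (f i x) \<le> M i" "\<And>i. 0 < M i"
    and R: "\<And>i x. x \<notin> cball 0 R \<Longrightarrow> f i x = 0"
  shows "BMO_norm (\<lambda>x. enn2real (square_function \<theta> f x)) \<le> ennreal (2 * (bmo_const * (\<Prod>i\<in>UNIV. M i)))"
proof -
  let ?g = "\<lambda>x. enn2real (square_function \<theta> f x)"
  have int: "set_integrable lebesgue K ?g" if K: "compact K" for K
  proof -
    obtain r where "K \<subseteq> cball 0 r"
      using compact_imp_bounded[OF K] by (auto simp: bounded_iff subset_iff)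
    then show ?thesis
      using K by (intro set_integrable_square_function[OF f M R]) (auto simp: borel_compact)
  qed
  have "average Q (\<lambda>x. \<bar>?g x - average Q ?g\<bar>) \<le> 2 * (bmo_const * (\<Prod>i\<in>UNIV. M i))" if Q: "Q \<in> cubes" for Q
  proof -
    obtain a l where Q: "Q = cbox a (a + vec l)" and l: "0 < l"
      using Q by (auto simp: cubes_def)
    have em: "emeasure lebesgue Q = ennreal (l ^ CARD('n))"
      using cube_props(1)[OF l, of a] by (simp add: Q)
    then have m: "measure lebesgue Q = l ^ CARD('n)"
      using l by (simp add: measure_def)
    obtain c where "(\<integral>\<^sup>+x\<in>Q. ennreal \<bar>?g x - c\<bar> \<partial>lborel)
        \<le> ennreal (bmo_const * (\<Prod>i\<in>UNIV. M i) * l ^ CARD('n))"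
      using cube_oscillation[where f = f and R = R and a = a, OF f M R l] unfolding Q by blast
    then have "(\<integral>\<^sup>+x\<in>Q. ennreal \<bar>?g x - c\<bar> \<partial>lebesgue)
        \<le> ennreal (bmo_const * (\<Prod>i\<in>UNIV. M i) * measure lebesgue Q)"
      by (simp only: m nn_integral_completion)
    moreover have "0 \<le> bmo_const * (\<Prod>i\<in>UNIV. M i)"
      using bmo_const_nonneg M(2) by (simp add: prod_nonneg less_imp_le)
    moreover have "0 < measure lebesgue Q" "emeasure lebesgue Q < \<infinity>"
      using l by (simp_all only: m em) simp_all
    moreover have "set_integrable lebesgue Q ?g"
      by (intro int) (simp add: Q)
    ultimately show ?thesis
      by (intro mean_oscillation_le) (simp_all add: Q)
  qed
  then have "(SUP Q\<in>cubes. ennreal (average Q (\<lambda>x. \<bar>?g x - average Q ?g\<bar>)))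
      \<le> ennreal (2 * (bmo_const * (\<Prod>i\<in>UNIV. M i)))"
    by (intro SUP_least ennreal_leI)
  then show ?thesis
    using int by (simp add: BMO_norm_def locally_integrable_def)
qed

end

lemma BMO_norm_zero: "BMO_norm (\<lambda>x. 0) = 0"
proof -
  have "(SUP Q\<in>cubes. ennreal (average Q (\<lambda>x. \<bar>0 - average Q (\<lambda>x. 0)\<bar>))) \<le> 0"
    by (rule SUP_least) (simp add: average_def set_lebesgue_integral_def)
  then show ?thesis
    by (simp add: BMO_norm_def locally_integrable_def set_integrable_def)
qed

text \<open>Finiteness almost everywhere is part of the conclusion so that \<open>enn2real\<close>
  changes the square function on a null set only.\<close>

theorem theorem4p1:
  fixes \<theta> :: "real \<Rightarrow> real^'n \<Rightarrow> real^'n^'m \<Rightarrow> complex"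
    and q :: "'m \<Rightarrow> ennreal" and p :: ennreal
  assumes measurable: "\<And>x y. (\<lambda>t. \<theta> t x y) \<in> borel_measurable (lebesgue_on {0<..})"
    and kernel: "kernel_conditions \<theta>"
    and exponents: "1 \<le> p" "\<And>i. 1 \<le> q i" "inverse p = (\<Sum>i\<in>UNIV. inverse (q i))"
    and bounded: "square_function_bounded \<theta> q p"
  shows "\<exists>C::real. \<forall>f. (\<forall>i. in_Linf_compact_support (f i)) \<longrightarrow>
           (AE x in lebesgue. square_function \<theta> f x < \<infinity>) \<and>
           BMO_norm (\<lambda>x. enn2real (square_function \<theta> f x))
             \<le> ennreal C * (\<Prod>i\<in>UNIV. Lp_norm_complex \<infinity> (f i))"
proof -
  obtain N \<gamma> A where "real CARD('n) < N" "0 < \<gamma>" "\<gamma> \<le> 1" "0 < A"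
    "\<forall>t>0. \<forall>x y. cmod (\<theta> t x y) \<le> A * kernel_majorant N \<gamma> t x y"
    "\<forall>t>0. \<forall>x y i z. cmod (\<theta> t x y - \<theta> t x (replace_component y i z))
        \<le> A * (norm (y $ i - z) / t) powr \<gamma> * kernel_majorant N \<gamma> t x y"
    "\<forall>t>0. \<forall>x x' y. cmod (\<theta> t x y - \<theta> t x' y)
        \<le> A * (norm (x - x') / t) powr \<gamma> * kernel_majorant N \<gamma> t x y"
    using kernel unfolding kernel_conditions_def by blast
  then have ker: "square_function_kernel \<theta> N \<gamma> A"
    using measurable by unfold_locales simp_all
  obtain C0 :: real where C0: "\<And>f. (\<And>i. in_Lp (q i) (f i)) \<Longrightarrow>
      Lp_norm p (square_function \<theta> f) \<le> ennreal C0 * (\<Prod>i\<in>UNIV. Lp_norm_complex (q i) (f i))"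
    using bounded unfolding square_function_bounded_def by blast
  \<comment> \<open>The given constant may be zero or negative; it is enlarged to a positive one, as
    the scale \<open>s = C' * ?P\<close> of the local estimate must be positive.\<close>
  have C': "Lp_norm p (square_function \<theta> f) \<le> ennreal (max C0 1) * (\<Prod>i\<in>UNIV. Lp_norm_complex (q i) (f i))"
    if "\<And>i. in_Lp (q i) (f i)" for f
    by (rule order_trans[OF C0[OF that]]) (auto intro!: mult_right_mono ennreal_leI)
  interpret bounded_square_function \<theta> N \<gamma> A q p "max C0 1"
    using ker exponents C' unfolding bounded_square_function_def bounded_square_function_axioms_def by simp
  show ?thesis
  proof (intro exI[of _ "2 * bmo_const"] allI impI)
    fix f :: "'m \<Rightarrow> real^'n \<Rightarrow> complex"
    assume "\<forall>i. in_Linf_compact_support (f i)"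
    then have f: "in_Linf_compact_support (f i)" for i by blast
    define M where "M i = enn2real (Lp_norm_complex \<infinity> (f i))" for i
    have M: "Lp_norm_complex \<infinity> (f i) = ennreal (M i)" "0 \<le> M i" for i
      using f[of i] by (simp_all add: M_def in_Linf_compact_support_def in_Lp_def)
    have ex: "\<forall>i. \<exists>g R. g \<in> borel_measurable borel \<and> (AE x in lborel. f i x = g x) \<and>
        (\<forall>x. cmod (g x) \<le> M i) \<and> (\<forall>x. x \<notin> cball 0 R \<longrightarrow> g x = 0)"
    proof
      fix i
      obtain g R where "g \<in> borel_measurable borel" "AE x in lborel. f i x = g x"
          "\<And>x. cmod (g x) \<le> M i" "\<And>x. x \<notin> cball 0 R \<Longrightarrow> g x = 0"
        by (rule in_Linf_compact_support_ex_borel[OF f[of i], folded M_def]) (rule that)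
      then show "\<exists>g R. g \<in> borel_measurable borel \<and> (AE x in lborel. f i x = g x) \<and>
          (\<forall>x. cmod (g x) \<le> M i) \<and> (\<forall>x. x \<notin> cball 0 R \<longrightarrow> g x = 0)"
        by blast
    qed
    from choice[OF ex] obtain g where "\<forall>i. \<exists>R. g i \<in> borel_measurable borel \<and>
        (AE x in lborel. f i x = g i x) \<and> (\<forall>x. cmod (g i x) \<le> M i) \<and> (\<forall>x. x \<notin> cball 0 R \<longrightarrow> g i x = 0)"
      by blast
    from choice[OF this] obtain r where g: "\<And>i. g i \<in> borel_measurable borel" "\<And>i. AE x in lborel. f i x = g i x"
        "\<And>i x. cmod (g i x) \<le> M i" and r: "\<And>i x. x \<notin> cball 0 (r i) \<Longrightarrow> g i x = 0"
      by blast
    define R where "R = Max (range r)"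
    have R: "g i x = 0" if "x \<notin> cball 0 R" for i x
    proof (rule r)
      have "r i \<le> R" by (simp add: R_def)
      then show "x \<notin> cball 0 (r i)" using that by auto
    qed
    have fg: "square_function \<theta> f = square_function \<theta> g"
      using square_function_eq[OF g(2,1)] square_function_eq[of g g, OF AE_I2[OF refl] g(1)] by simp
    have prod: "ennreal (2 * bmo_const) * (\<Prod>i\<in>UNIV. Lp_norm_complex \<infinity> (f i))
        = ennreal (2 * (bmo_const * (\<Prod>i\<in>UNIV. M i)))"
      using M bmo_const_nonneg by (simp add: prod_ennreal ennreal_mult'[symmetric] mult.assoc)
    show "(AE x in lebesgue. square_function \<theta> f x < \<infinity>) \<and>
        BMO_norm (\<lambda>x. enn2real (square_function \<theta> f x))
          \<le> ennreal (2 * bmo_const) * (\<Prod>i\<in>UNIV. Lp_norm_complex \<infinity> (f i))"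
    \<comment> \<open>The estimates require strictly positive bounds \<open>M i\<close>. If some
      \<open>M j\<close> is 0, then \<open>g j\<close> vanishes at every point and the square
      function is identically 0.\<close>
    proof (cases "\<forall>i. 0 < M i")
      case True
      then have pos: "0 < M i" for i by simp
      show ?thesis
        unfolding fg prod AE_completion_iff
        by (intro conjI square_function_finite_AE[of g M R] BMO_norm_square_function_le[of g M R])
          (rule g pos R, assumption?)+
    next
      case False
      then obtain j where "\<not> 0 < M j" by blast
      then have "M j = 0" using M(2)[of j] by simp
      then have "g j x = 0" for x using g(3)[of j x] by simp
      then have prod_0: "(\<Prod>i\<in>UNIV. g i (y $ i)) = 0" for y :: "real^'n^'m"
        by (intro prod_zero) auto
      have "square_function \<theta> g x = 0" for x
        by (simp only: square_function_eq[of g g, OF AE_I2[OF refl] g(1)] kernel_integral_def prod_0)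
          (simp add: dilation_L2_norm_def enn_powr_zero)
      then show ?thesis by (simp add: fg BMO_norm_zero)
    qed
  qed
qed

end
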